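(* Let $l\ge 1$. The ideal of the reduced scheme $S_l$ in $\mathbb{C}[x_0^{(i)},\dots,x_l^{(i)}]_{i\ge 0}$, that is, $\sqrt{I_l^\infty}=\ker\nu_l$, is generated by (quadratic elements, namely) all the coefficients in $t$ of all the series $$Q_{s,r,w}=\sum_{u=s}^{r-1}(-1)^u\binom{r-s-1}{u-s}\,\frac{d^w x_u(t)}{dt^w}\,x_{r+s-u}(t),$$ where $0\le s,r\le l$, $r-s\ge 2$ and $0\le w\le r-s-2$.
   Context: Let $\mathbb{C}[x_0^{(i)},\dots,x_l^{(i)}]_{i\ge 0}$ be the polynomial ring in the infinitely many variables $x_j^{(i)}$, $0\le j\le l$, $i\ge 0$, and put $x_j(t)=\sum_{i\ge 0}x_j^{(i)}t^i$. Derivatives $\frac{d^w}{dt^w}$ of series are formal. The image of the Veronese embedding $\mathbb{P}^1\to\mathbb{P}^l$ is cut out by the relations $x_ax_b=x_{a-1}x_{b+1}$, $1\le a\le b\le l-1$. The corresponding arc scheme is defined by the ideal $I_l^\infty$ generated by all coefficients in $t$ of the series $x_a(t)x_b(t)-x_{a-1}(t)x_{b+1}(t)$, $1\le a\le b\le l-1$. $S_l$ denotes the corresponding reduced scheme. Let $a(t)=\sum_{i\ge0}a^{(i)}t^i$, $b(t)=\sum_{i\ge0}b^{(i)}t^i$ with independent variables $a^{(i)},b^{(i)}$. The semi-infinite Veronese map $(a(t):b(t))\mapsto (a(t)^l:a(t)^{l-1}b(t):\dots:b(t)^l)$ from $\mathbb{P}(\mathbb{C}^2[[t]])$ to $\mathbb{P}(\mathbb{C}^{l+1}[[t]])$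 corresponds to the ring homomorphism $$\nu_l:\mathbb{C}[x_0^{(i)},\dots,x_l^{(i)}]_{i\ge0}\to\mathbb{C}[a^{(i)},b^{(i)}]_{i\ge0},\qquad x_j(t)\mapsto a(t)^{l-j}b(t)^j,$$ meaning that $x_j^{(i)}$ is mapped to the coefficient of $t^i$ in $a(t)^{l-j}b(t)^j$. The ring $\mathbb{C}[x_0^{(i)},\dots,x_l^{(i)}]/\ker\nu_l$ is the homogeneous coordinate ring of the reduced semi-infinite Veronese curve. *)

theory Defs
  imports
    "HOL-Library.Poly_Mapping"
    "HOL-Computational_Algebra.Formal_Power_Series"
    "HOL-Algebra.RingHom"
begin

(* Polynomials over the complex numbers in variables of type 'v: a monomial is a finitely
   supported exponent function, a polynomial a finitely supported coefficient function.
   The multiplication of the type is convolution. *)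
type_synonym 'v cpoly = "('v \<Rightarrow>\<^sub>0 nat) \<Rightarrow>\<^sub>0 complex"

definition var :: "'v \<Rightarrow> 'v cpoly" where
  "var v = Poly_Mapping.single (Poly_Mapping.single v 1) 1"

definition const :: "complex \<Rightarrow> 'v cpoly" where
  "const c = Poly_Mapping.single 0 c"

(* The polynomials in the variables from V. They form a ring of their own, and the ideals below
   are ideals of that ring: their cofactors, too, involve variables from V only. *)
definition polys_in :: "'v set \<Rightarrow> 'v cpoly set" where
  "polys_in V = {p. \<forall>m\<in>Poly_Mapping.keys p. Poly_Mapping.keys m \<subseteq> V}"

definition poly_ring :: "'v set \<Rightarrow> 'v cpoly ring" where
  "poly_ring V = \<lparr>carrier = polys_in V, mult = (*), one = 1, zero = 0, add = (+)\<rparr>"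

definition homogeneous :: "nat \<Rightarrow> 'v cpoly \<Rightarrow> bool" where
  "homogeneous d p \<longleftrightarrow>
     (\<forall>m\<in>Poly_Mapping.keys p. (\<Sum>v\<in>Poly_Mapping.keys m. Poly_Mapping.lookup m v) = d)"

definition eval_monom :: "('v \<Rightarrow> 'w cpoly) \<Rightarrow> ('v \<Rightarrow>\<^sub>0 nat) \<Rightarrow> 'w cpoly" where
  "eval_monom f m = (\<Prod>v\<in>Poly_Mapping.keys m. f v ^ Poly_Mapping.lookup m v)"

(* The C-algebra homomorphism sending the variable v to f v. *)
definition subst_hom :: "('v \<Rightarrow> 'w cpoly) \<Rightarrow> 'v cpoly \<Rightarrow> 'w cpoly" where
  "subst_hom f p = (\<Sum>m\<in>Poly_Mapping.keys p. const (Poly_Mapping.lookup p m) * eval_monom f m)"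

definition ideal_radical :: "('a, 'b) ring_scheme \<Rightarrow> 'a set \<Rightarrow> 'a set" where
  "ideal_radical R I = {p \<in> carrier R. \<exists>n::nat. p [^]\<^bsub>R\<^esub> n \<in> I}"

(* The pair (j, i) stands for the variable $x_j^{(i)}$. *)
definition x_ring :: "nat \<Rightarrow> (nat \<times> nat) cpoly ring" where
  "x_ring l = poly_ring ({0..l} \<times> UNIV)"

definition x_ser :: "nat \<Rightarrow> (nat \<times> nat) cpoly fps" where
  "x_ser j = Abs_fps (\<lambda>i. var (j, i))"

definition arc_gens :: "nat \<Rightarrow> (nat \<times> nat) cpoly set" where
  "arc_gens l = {fps_nth (x_ser a * x_ser b - x_ser (a - 1) * x_ser (b + 1)) n | a b n.
                   1 \<le> a \<and> a \<le> b \<and> b \<le> l - 1}"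

definition arc_ideal :: "nat \<Rightarrow> (nat \<times> nat) cpoly set" where
  "arc_ideal l = Idl\<^bsub>x_ring l\<^esub> (arc_gens l)"

datatype ab_var = A nat | B nat

definition ab_ring :: "ab_var cpoly ring" where
  "ab_ring = poly_ring UNIV"

definition a_ser :: "ab_var cpoly fps" where
  "a_ser = Abs_fps (\<lambda>i. var (A i))"

definition b_ser :: "ab_var cpoly fps" where
  "b_ser = Abs_fps (\<lambda>i. var (B i))"

definition nu :: "nat \<Rightarrow> (nat \<times> nat) cpoly \<Rightarrow> ab_var cpoly" where
  "nu l = subst_hom (\<lambda>(j, i). fps_nth (a_ser ^ (l - j) * b_ser ^ j) i)"

definition Q_ser :: "nat \<Rightarrow> nat \<Rightarrow> nat \<Rightarrow> (nat \<times> nat) cpoly fps" where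
  "Q_ser s r w = (\<Sum>u = s..r - 1. (-1) ^ u * of_nat ((r - s - 1) choose (u - s))
                     * (fps_deriv ^^ w) (x_ser u) * x_ser (r + s - u))"

definition Q_gens :: "nat \<Rightarrow> (nat \<times> nat) cpoly set" where
  "Q_gens l = {fps_nth (Q_ser s r w) n | s r w n. s \<le> l \<and> r \<le> l \<and> s + 2 \<le> r \<and> w \<le> r - s - 2}"


lemma lookup_sum_pm:
  "Poly_Mapping.lookup (sum f S) k = (\<Sum>i\<in>S. Poly_Mapping.lookup (f i) k)"
  by (induction S rule: infinite_finite_induct) (auto simp: lookup_add)

lemma poly_eq_sum_single:
  "p = (\<Sum>m\<in>Poly_Mapping.keys p. Poly_Mapping.single m (Poly_Mapping.lookup p m))"
  by (rule poly_mapping_eqI)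
     (simp add: lookup_sum_pm lookup_single when_def sum.delta not_in_keys_iff_lookup_eq_zero)

lemma zero_in_polys: "0 \<in> polys_in V" and one_in_polys: "1 \<in> polys_in V"
  by (auto simp: polys_in_def simp flip: single_one)

lemma const_in_polys: "const c \<in> polys_in V"
  by (auto simp: polys_in_def const_def)

lemma var_in_polys: "v \<in> V \<Longrightarrow> var v \<in> polys_in V"
  by (auto simp: polys_in_def var_def)

lemma add_in_polys: "p \<in> polys_in V \<Longrightarrow> q \<in> polys_in V \<Longrightarrow> p + q \<in> polys_in V"
  using Poly_Mapping.keys_add[of p q] by (fastforce simp: polys_in_def)

lemma uminus_in_polys: "p \<in> polys_in V \<Longrightarrow> - p \<in> polys_in V"
  by (simp add: polys_in_def)

lemma mult_in_polys:
  assumes "p \<in> polys_in V" "q \<in> polys_in V" shows "p * q \<in> polys_in V"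
  unfolding polys_in_def
proof (intro CollectI ballI)
  fix m assume "m \<in> Poly_Mapping.keys (p * q)"
  then obtain m1 m2 where "m = m1 + m2" "m1 \<in> Poly_Mapping.keys p" "m2 \<in> Poly_Mapping.keys q"
    using Poly_Mapping.keys_mult[of p q] by blast
  then show "Poly_Mapping.keys m \<subseteq> V"
    using assms Poly_Mapping.keys_add[of m1 m2] unfolding polys_in_def by blast
qed

lemma diff_in_polys: "p \<in> polys_in V \<Longrightarrow> q \<in> polys_in V \<Longrightarrow> p - q \<in> polys_in V"
  using add_in_polys[of p V "- q"] uminus_in_polys[of q V] by simp

lemma sum_in_polys: "(\<And>i. i \<in> S \<Longrightarrow> f i \<in> polys_in V) \<Longrightarrow> sum f S \<in> polys_in V"
  by (induction S rule: infinite_finite_induct) (auto intro: zero_in_polys add_in_polys)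

lemma cring_poly_ring: "cring (poly_ring V)"
proof (rule cringI)
  show "abelian_group (poly_ring V)"
  proof (rule abelian_groupI)
    fix p assume "p \<in> carrier (poly_ring V)"
    then show "\<exists>q\<in>carrier (poly_ring V). q \<oplus>\<^bsub>poly_ring V\<^esub> p = \<zero>\<^bsub>poly_ring V\<^esub>"
      by (intro bexI[of _ "- p"]) (auto simp: poly_ring_def uminus_in_polys)
  qed (auto simp: poly_ring_def add_in_polys zero_in_polys ac_simps)
  show "comm_monoid (poly_ring V)"
    by (rule comm_monoidI) (auto simp: poly_ring_def mult_in_polys one_in_polys ac_simps)
qed (auto simp: poly_ring_def algebra_simps)

lemma const_zero [simp]: "const 0 = 0" and const_one [simp]: "const 1 = 1"
  by (simp_all add: const_def)

lemma const_add: "const (c + d) = const c + const d"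
  by (simp add: const_def single_add)

lemma const_mult: "const (c * d) = const c * const d"
  by (simp add: const_def mult_single)

lemma eval_monom_superset:
  assumes "finite S" "Poly_Mapping.keys m \<subseteq> S"
  shows "eval_monom f m = (\<Prod>v\<in>S. f v ^ Poly_Mapping.lookup m v)"
  unfolding eval_monom_def
  by (rule prod.mono_neutral_left) (use assms in \<open>auto simp: in_keys_iff\<close>)

lemma eval_monom_zero [simp]: "eval_monom f 0 = 1"
  by (simp add: eval_monom_def)

lemma eval_monom_add: "eval_monom f (m + n) = eval_monom f m * eval_monom f n"
proof -
  let ?S = "Poly_Mapping.keys m \<union> Poly_Mapping.keys n"
  have "Poly_Mapping.keys (m + n) \<subseteq> ?S" by (rule Poly_Mapping.keys_add)
  then show ?thesis
    by (simp add: eval_monom_superset[of ?S] lookup_add power_add prod.distrib)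
qed

lemma subst_hom_superset:
  assumes "finite S" "Poly_Mapping.keys p \<subseteq> S"
  shows "subst_hom f p = (\<Sum>m\<in>S. const (Poly_Mapping.lookup p m) * eval_monom f m)"
  unfolding subst_hom_def
  by (rule sum.mono_neutral_left) (use assms in \<open>auto simp: in_keys_iff\<close>)

lemma subst_hom_zero [simp]: "subst_hom f 0 = 0"
  by (simp add: subst_hom_def)

lemma subst_hom_add: "subst_hom f (p + q) = subst_hom f p + subst_hom f q"
proof -
  let ?S = "Poly_Mapping.keys p \<union> Poly_Mapping.keys q"
  have "Poly_Mapping.keys (p + q) \<subseteq> ?S" by (rule Poly_Mapping.keys_add)
  then show ?thesis
    by (simp add: subst_hom_superset[of ?S] lookup_add const_add algebra_simps sum.distrib)
qed

lemma subst_hom_sum: "subst_hom f (sum g S) = (\<Sum>i\<in>S. subst_hom f (g i))"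
  by (induction S rule: infinite_finite_induct) (auto simp: subst_hom_add)

lemma subst_hom_single: "subst_hom f (Poly_Mapping.single m c) = const c * eval_monom f m"
  by (simp add: subst_hom_superset[of "{m}"])

lemma subst_hom_const: "subst_hom f (const c) = const c"
  by (simp add: const_def subst_hom_single)

lemma subst_hom_var: "subst_hom f (var v) = f v"
  by (simp add: var_def subst_hom_single eval_monom_def)

lemma subst_hom_mult: "subst_hom f (p * q) = subst_hom f p * subst_hom f q"
proof -
  let ?s = "\<lambda>p m. Poly_Mapping.single m (Poly_Mapping.lookup p m)"
  let ?K = "Poly_Mapping.keys"
  have "p * q = (\<Sum>m\<in>?K p. ?s p m) * (\<Sum>n\<in>?K q. ?s q n)"
    by (simp flip: poly_eq_sum_single)
  also have "subst_hom f \<dots> = (\<Sum>m\<in>?K p. \<Sum>n\<in>?K q. subst_hom f (?s p m * ?s q n))"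
    by (simp add: sum_product subst_hom_sum)
  also have "\<dots> = (\<Sum>m\<in>?K p. \<Sum>n\<in>?K q.
      (const (Poly_Mapping.lookup p m) * eval_monom f m) *
      (const (Poly_Mapping.lookup q n) * eval_monom f n))"
    by (simp add: mult_single subst_hom_single const_mult eval_monom_add mult_ac)
  also have "\<dots> = subst_hom f p * subst_hom f q"
    by (simp add: subst_hom_def sum_product)
  finally show ?thesis .
qed

lemma nu_ring_hom: "nu l \<in> ring_hom (x_ring l) ab_ring"
  unfolding x_ring_def ab_ring_def poly_ring_def nu_def
  by (rule ring_hom_memI)
     (auto simp: subst_hom_mult subst_hom_add polys_in_def subst_hom_const[of _ 1, simplified])

lemma nu_const: "nu l (const c) = const c"
  by (simp add: nu_def subst_hom_const)

lemma nu_var: "nu l (var (j, i)) = fps_nth (a_ser ^ (l - j) * b_ser ^ j) i"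
  by (simp add: nu_def subst_hom_var)

lemma fps_nth_mult_in_polys:
  assumes "\<And>i. fps_nth f i \<in> polys_in V" "\<And>i. fps_nth g i \<in> polys_in V"
  shows "fps_nth (f * g) n \<in> polys_in V"
  using assms by (auto simp: fps_mult_nth intro!: sum_in_polys mult_in_polys)

lemma x_ser_in: "j \<le> l \<Longrightarrow> fps_nth (x_ser j) i \<in> polys_in ({0..l} \<times> UNIV)"
  by (auto simp: x_ser_def intro: var_in_polys)

lemma arc_gens_carrier: "arc_gens l \<subseteq> carrier (x_ring l)"
  by (auto simp: arc_gens_def x_ring_def poly_ring_def
      intro!: diff_in_polys fps_nth_mult_in_polys x_ser_in)

lemma of_nat_in_polys: "of_nat n \<in> polys_in V"
  by (induction n) (auto intro: zero_in_polys one_in_polys add_in_polys)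

lemma fps_deriv_in_polys:
  assumes "\<And>i. fps_nth f i \<in> polys_in V"
  shows "fps_nth ((fps_deriv ^^ w) f) n \<in> polys_in V"
  using assms
proof (induction w arbitrary: n)
  case (Suc w)
  then show ?case
    by (auto simp del: of_nat_Suc intro!: mult_in_polys of_nat_in_polys)
qed simp

lemma fps_sign_in_polys: "fps_nth ((-1) ^ u * of_nat k) n \<in> polys_in V"
proof -
  have "(-1) ^ u * of_nat k = (fps_const ((-1) ^ u * of_nat k) :: 'a cpoly fps)"
    by (cases "even u") (simp_all add: fps_of_nat[symmetric])
  then show ?thesis
    by (cases "even u") (auto intro: of_nat_in_polys uminus_in_polys zero_in_polys)
qed

lemma Q_gens_carrier: "Q_gens l \<subseteq> carrier (x_ring l)"
  unfolding Q_gens_def Q_ser_def x_ring_def poly_ring_def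
  by (auto simp: fps_sum_nth intro!: sum_in_polys fps_nth_mult_in_polys[OF fps_nth_mult_in_polys]
      fps_sign_in_polys fps_deriv_in_polys x_ser_in)

end

theory Submission
  imports Defs "HOL-Computational_Algebra.Formal_Laurent_Series"
begin

text \<open>
  Let \<open>J\<close> be the ideal of the quadratic relations, and order the variables by their lower index.
  Elements of the kernel are shown to lie in \<open>J\<close> by induction on the last index \<open>l\<close> that occurs and
  on the degree \<open>n\<close> in the variables of \<open>\<xi>(t) = x_l(t)\<close>, for a fixed target exponent \<open>L \<ge> l\<close>.
  The substitution \<open>x_u(z) := (v - z)^(l-1-u) x_u(z)\<close>, expanded for \<open>|v| > |z|\<close>, preserves the kernel, being
  induced by a twist of \<open>a(t)\<close> and \<open>b(t)\<close> by \<open>L\<close>-th roots. It is polynomial in \<open>v\<close> on \<open>x_u\<close> for \<open>u < l\<close> and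
  has a simple pole, with residue \<open>\<xi>(v)\<close>, on \<open>x_l\<close>. Hence the polar part of the twist of an element
  \<open>f\<close>, divided by \<open>\<xi>(v)\<close>, has coefficients of \<open>\<xi>\<close>-degree \<open>n - 1\<close>; they are again in the kernel
  because the target is a domain. Twisting them back, multiplying by \<open>\<xi>(v)\<close> and taking the residue
  gives \<open>n f\<close> up to terms of smaller \<open>\<xi>\<close>-degree and up to residues that involve only the derivatives
  \<open>\<xi>(t) x_u^{(w)}(t)\<close> with \<open>w \<le> l - u - 2\<close>, which the quadratic relations express through \<open>x_0, \<dots>, x_{l-1}\<close>.
  That the relations are nilpotent on the arc scheme follows by multiplying with powers of \<open>x_0\<close>,
  since then \<open>x_j\<close> may be replaced by \<open>x_0 (x_1/x_0)^j\<close>, and by differential algebra in a reduced ring.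
\<close>

subsection \<open>Ring homomorphisms out of polynomial rings\<close>

definition ring_map :: "('a::comm_ring_1 \<Rightarrow> 'b::comm_ring_1) \<Rightarrow> bool" where
  "ring_map h \<longleftrightarrow> h 1 = 1 \<and> (\<forall>x y. h (x + y) = h x + h y) \<and> (\<forall>x y. h (x * y) = h x * h y)"

lemma ring_map_add: "ring_map h \<Longrightarrow> h (x + y) = h x + h y"
  and ring_map_mult: "ring_map h \<Longrightarrow> h (x * y) = h x * h y"
  and ring_map_one: "ring_map h \<Longrightarrow> h 1 = 1"
  by (simp_all add: ring_map_def)

lemma ring_map_zero: "ring_map h \<Longrightarrow> h 0 = 0"
  using ring_map_add[of h 0 0] by simp

lemma ring_map_sum: "ring_map h \<Longrightarrow> h (sum f S) = (\<Sum>i\<in>S. h (f i))"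
  by (induction S rule: infinite_finite_induct) (auto simp: ring_map_zero ring_map_add)

lemma ring_map_power: "ring_map h \<Longrightarrow> h (x ^ n) = h x ^ n"
  by (induction n) (auto simp: ring_map_one ring_map_mult)

lemma ring_map_comp: "ring_map g \<Longrightarrow> ring_map h \<Longrightarrow> ring_map (\<lambda>x. g (h x))"
  by (simp add: ring_map_def)

text \<open>One construction serves two purposes: evaluating polynomials, with monomials as keys,
  and mapping Laurent polynomials, with integer exponents as keys.\<close>

definition pm_lift ::
    "('c::comm_ring_1 \<Rightarrow> 'b::comm_ring_1) \<Rightarrow> ('k::comm_monoid_add \<Rightarrow> 'b) \<Rightarrow> ('k \<Rightarrow>\<^sub>0 'c) \<Rightarrow> 'b" where
  "pm_lift \<phi> \<psi> p = (\<Sum>k\<in>Poly_Mapping.keys p. \<phi> (Poly_Mapping.lookup p k) * \<psi> k)"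

lemma pm_lift_superset:
  assumes "ring_map \<phi>" "finite S" "Poly_Mapping.keys p \<subseteq> S"
  shows "pm_lift \<phi> \<psi> p = (\<Sum>k\<in>S. \<phi> (Poly_Mapping.lookup p k) * \<psi> k)"
  unfolding pm_lift_def
  by (rule sum.mono_neutral_left) (use assms in \<open>auto simp: in_keys_iff ring_map_zero\<close>)

lemma pm_lift_single:
  assumes "ring_map \<phi>"
  shows "pm_lift \<phi> \<psi> (Poly_Mapping.single k c) = \<phi> c * \<psi> k"
  by (simp add: pm_lift_superset[OF assms, of "{k}"])

lemma ring_map_pm_lift:
  fixes \<phi> :: "'c::comm_ring_1 \<Rightarrow> 'b::comm_ring_1" and \<psi> :: "'k::comm_monoid_add \<Rightarrow> 'b"
  assumes "ring_map \<phi>" "\<psi> 0 = 1" "\<And>j k. \<psi> (j + k) = \<psi> j * \<psi> k"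
  shows "ring_map (pm_lift \<phi> \<psi>)"
proof -
  have add: "pm_lift \<phi> \<psi> (p + q) = pm_lift \<phi> \<psi> p + pm_lift \<phi> \<psi> q" for p q
  proof -
    let ?S = "Poly_Mapping.keys p \<union> Poly_Mapping.keys q"
    have "Poly_Mapping.keys (p + q) \<subseteq> ?S" by (rule Poly_Mapping.keys_add)
    then show ?thesis
      by (simp add: pm_lift_superset[OF assms(1), of ?S] lookup_add ring_map_add[OF assms(1)]
          algebra_simps sum.distrib)
  qed
  have sums: "pm_lift \<phi> \<psi> (sum g S) = (\<Sum>i\<in>S. pm_lift \<phi> \<psi> (g i))" for g :: "'d \<Rightarrow> _" and S
    by (induction S rule: infinite_finite_induct) (auto simp: add, auto simp: pm_lift_def)
  have mult: "pm_lift \<phi> \<psi> (p * q) = pm_lift \<phi> \<psi> p * pm_lift \<phi> \<psi> q" for p q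
  proof -
    let ?s = "\<lambda>p m. Poly_Mapping.single m (Poly_Mapping.lookup p m)"
    let ?K = "Poly_Mapping.keys"
    have eq: "r = (\<Sum>m\<in>?K r. ?s r m)" for r :: "'k \<Rightarrow>\<^sub>0 'c"
      by (rule poly_mapping_eqI)
        (simp add: lookup_sum_pm lookup_single when_def sum.delta not_in_keys_iff_lookup_eq_zero)
    have "p * q = (\<Sum>m\<in>?K p. ?s p m) * (\<Sum>n\<in>?K q. ?s q n)"
      by (simp flip: eq)
    also have "pm_lift \<phi> \<psi> \<dots> = (\<Sum>m\<in>?K p. \<Sum>n\<in>?K q. pm_lift \<phi> \<psi> (?s p m * ?s q n))"
      by (simp add: sum_product sums)
    also have "\<dots> = (\<Sum>m\<in>?K p. \<Sum>n\<in>?K q.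
        (\<phi> (Poly_Mapping.lookup p m) * \<psi> m) * (\<phi> (Poly_Mapping.lookup q n) * \<psi> n))"
      by (simp add: mult_single pm_lift_single[OF assms(1)] ring_map_mult[OF assms(1)] assms(3) mult_ac)
    also have "\<dots> = pm_lift \<phi> \<psi> p * pm_lift \<phi> \<psi> q"
      by (simp add: pm_lift_def sum_product)
    finally show ?thesis .
  qed
  have "pm_lift \<phi> \<psi> 1 = 1"
    using pm_lift_single[OF assms(1), of \<psi> 0 1] by (simp add: ring_map_one[OF assms(1)] assms(2))
  then show ?thesis by (simp add: ring_map_def add mult)
qed

section \<open>Evaluation of polynomials in an arbitrary commutative algebra\<close>

definition monom_at :: "('v \<Rightarrow> 'b::comm_ring_1) \<Rightarrow> ('v \<Rightarrow>\<^sub>0 nat) \<Rightarrow> 'b" where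
  "monom_at f m = (\<Prod>v\<in>Poly_Mapping.keys m. f v ^ Poly_Mapping.lookup m v)"

lemma monom_at_superset:
  assumes "finite S" "Poly_Mapping.keys m \<subseteq> S"
  shows "monom_at f m = (\<Prod>v\<in>S. f v ^ Poly_Mapping.lookup m v)"
  unfolding monom_at_def
  by (rule prod.mono_neutral_left) (use assms in \<open>auto simp: in_keys_iff\<close>)

lemma monom_at_add: "monom_at f (m + n) = monom_at f m * monom_at f n"
proof -
  let ?S = "Poly_Mapping.keys m \<union> Poly_Mapping.keys n"
  have "Poly_Mapping.keys (m + n) \<subseteq> ?S" by (rule Poly_Mapping.keys_add)
  then show ?thesis
    by (simp add: monom_at_superset[of ?S] lookup_add power_add prod.distrib)
qed

definition poly_eval :: "(complex \<Rightarrow> 'b::comm_ring_1) \<Rightarrow> ('v \<Rightarrow> 'b) \<Rightarrow> 'v cpoly \<Rightarrow> 'b" where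
  "poly_eval \<phi> f = pm_lift \<phi> (monom_at f)"

lemma ring_map_poly_eval: "ring_map \<phi> \<Longrightarrow> ring_map (poly_eval \<phi> f)"
  unfolding poly_eval_def
  by (rule ring_map_pm_lift) (auto simp: monom_at_add, simp add: monom_at_def)

lemma poly_eval_const: "ring_map \<phi> \<Longrightarrow> poly_eval \<phi> f (const c) = \<phi> c"
  by (simp add: poly_eval_def const_def pm_lift_single monom_at_def)

lemma poly_eval_var: "ring_map \<phi> \<Longrightarrow> poly_eval \<phi> f (var v) = f v"
  by (simp add: poly_eval_def var_def pm_lift_single monom_at_def ring_map_one)

lemma ring_map_const: "ring_map const"
  by (simp add: ring_map_def const_add const_mult)

lemma ring_map_subst_hom: "ring_map (subst_hom f)"
  by (simp add: ring_map_def subst_hom_add subst_hom_mult subst_hom_const[of f 1, simplified])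

lemma ring_map_fls_const: "ring_map fls_const"
  by (simp add: ring_map_def fls_plus_const)

lemma ring_map_single: "ring_map (Poly_Mapping.single (0::'k::comm_monoid_add))"
  by (simp add: ring_map_def single_add mult_single)

lemma polys_in_induct [consumes 1, case_names const add var]:
  assumes "p \<in> polys_in V"
    and const: "\<And>c. P (const c)"
    and add: "\<And>p q. p \<in> polys_in V \<Longrightarrow> q \<in> polys_in V \<Longrightarrow> P p \<Longrightarrow> P q \<Longrightarrow> P (p + q)"
    and var: "\<And>v p. v \<in> V \<Longrightarrow> p \<in> polys_in V \<Longrightarrow> P p \<Longrightarrow> P (var v * p)"
  shows "P p"
proof -
  have single_in: "Poly_Mapping.single m c \<in> polys_in V" if "Poly_Mapping.keys m \<subseteq> V" for m c
    using that by (auto simp: polys_in_def)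
  have mono: "P (Poly_Mapping.single m c)" if "Poly_Mapping.keys m \<subseteq> V" for m c
    using that
  proof (induction "\<Sum>v\<in>Poly_Mapping.keys m. Poly_Mapping.lookup m v" arbitrary: m)
    case 0
    then have "m = 0"
      by (metis finite_keys in_keys_iff keys_eq_empty sum_eq_0_iff all_not_in_conv)
    then show ?case using const[of c] by (simp add: const_def)
  next
    case (Suc n)
    then obtain v where v: "v \<in> Poly_Mapping.keys m"
      by (metis all_not_in_conv nat.simps(3) sum.empty)
    define m' where "m' = m - Poly_Mapping.single v 1"
    have m: "m = Poly_Mapping.single v 1 + m'"
      by (rule poly_mapping_eqI)
        (use v in \<open>auto simp: m'_def lookup_add lookup_minus lookup_single when_def in_keys_iff\<close>)
    have keys: "Poly_Mapping.keys m' \<subseteq> Poly_Mapping.keys m"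
      by (auto simp: m'_def in_keys_iff lookup_minus)
    have "(\<Sum>w\<in>Poly_Mapping.keys m'. Poly_Mapping.lookup m' w) =
          (\<Sum>w\<in>Poly_Mapping.keys m. Poly_Mapping.lookup m' w)"
      using keys by (intro sum.mono_neutral_left) (auto simp: in_keys_iff)
    also have "\<dots> + 1 = (\<Sum>w\<in>Poly_Mapping.keys m. Poly_Mapping.lookup m' w + (if w = v then 1 else 0))"
      using v by (simp add: sum.distrib)
    also have "\<dots> = (\<Sum>w\<in>Poly_Mapping.keys m. Poly_Mapping.lookup m w)"
    proof (rule sum.cong)
      fix w
      have "Poly_Mapping.lookup m w = Poly_Mapping.lookup (Poly_Mapping.single v 1 + m') w"
        using m by simp
      then show "Poly_Mapping.lookup m' w + (if w = v then 1 else 0) = Poly_Mapping.lookup m w"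
        by (simp add: lookup_add lookup_single when_def)
    qed simp
    finally have "n = (\<Sum>w\<in>Poly_Mapping.keys m'. Poly_Mapping.lookup m' w)"
      using Suc.hyps(2) by simp
    then have "P (Poly_Mapping.single m' c)"
      using Suc keys by blast
    moreover have "v \<in> V" using v Suc.prems by blast
    ultimately have "P (var v * Poly_Mapping.single m' c)"
      using keys Suc.prems by (intro var single_in) auto
    then show ?case using m by (simp add: var_def mult_single)
  qed
  have "P (\<Sum>m\<in>S. Poly_Mapping.single m (Poly_Mapping.lookup p m))"
    if "finite S" "S \<subseteq> Poly_Mapping.keys p" for S
    using that
  proof (induction S)
    case empty
    then show ?case using const[of 0] by simp
  next
    case (insert m S)
    have *: "Poly_Mapping.keys m \<subseteq> V" if "m \<in> Poly_Mapping.keys p" for m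
      using that assms(1) by (auto simp: polys_in_def)
    have "(\<Sum>m\<in>S. Poly_Mapping.single m (Poly_Mapping.lookup p m)) \<in> polys_in V"
      using insert * by (intro sum_in_polys single_in) auto
    then show ?case using insert * by (auto intro!: add mono single_in)
  qed
  from this[of "Poly_Mapping.keys p"] show ?thesis
    by (simp flip: poly_eq_sum_single)
qed

lemma ring_map_eq_on_polys:
  assumes "p \<in> polys_in V" "ring_map g" "ring_map h"
    "\<And>c. g (const c) = h (const c)" "\<And>v. v \<in> V \<Longrightarrow> g (var v) = h (var v)"
  shows "g p = h p"
  using assms(1)
  by (induction p rule: polys_in_induct) (auto simp: assms ring_map_add[OF assms(2)]
      ring_map_add[OF assms(3)] ring_map_mult[OF assms(2)] ring_map_mult[OF assms(3)])

lemma polys_in_UNIV: "p \<in> polys_in UNIV"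
  by (simp add: polys_in_def)

lemma polys_in_mono: "U \<subseteq> V \<Longrightarrow> p \<in> polys_in U \<Longrightarrow> p \<in> polys_in V"
  by (auto simp: polys_in_def)

subsection \<open>Ideals generated by a set\<close>

text \<open>For polynomials, the cofactors may contain variables outside x_0, ..., x_l;
  \<open>gen_ideal_imp_genideal\<close> removes these at the end.\<close>

inductive_set gen_ideal :: "'a::comm_ring_1 set \<Rightarrow> 'a set" for G where
  gen_ideal_zero: "0 \<in> gen_ideal G"
| gen_ideal_add_gen: "p \<in> gen_ideal G \<Longrightarrow> g \<in> G \<Longrightarrow> p + h * g \<in> gen_ideal G"

lemma gen_ideal_add: "p \<in> gen_ideal G \<Longrightarrow> q \<in> gen_ideal G \<Longrightarrow> p + q \<in> gen_ideal G"
  by (rotate_tac 1, induction q rule: gen_ideal.induct) (auto simp flip: add.assoc intro: gen_ideal.intros)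

lemma gen_ideal_mult: "p \<in> gen_ideal G \<Longrightarrow> h * p \<in> gen_ideal G"
  by (induction p rule: gen_ideal.induct)
    (auto simp: distrib_left simp flip: mult.assoc intro: gen_ideal.intros)

lemma gen_ideal_gen: "g \<in> G \<Longrightarrow> g \<in> gen_ideal G"
  using gen_ideal_add_gen[OF gen_ideal_zero, of g G 1] by simp

lemma gen_ideal_mono: "p \<in> gen_ideal G \<Longrightarrow> G \<subseteq> H \<Longrightarrow> p \<in> gen_ideal H"
  by (induction p rule: gen_ideal.induct) (auto intro: gen_ideal.intros)

lemma gen_ideal_sum: "(\<And>i. i \<in> S \<Longrightarrow> f i \<in> gen_ideal G) \<Longrightarrow> sum f S \<in> gen_ideal G"
  by (induction S rule: infinite_finite_induct) (auto intro: gen_ideal_zero gen_ideal_add)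

lemma gen_ideal_uminus: "p \<in> gen_ideal G \<Longrightarrow> - p \<in> gen_ideal G"
  using gen_ideal_mult[of p G "-1"] by simp

lemma ring_map_vanishes_gen_ideal:
  assumes "ring_map h" "\<And>g. g \<in> G \<Longrightarrow> h g = 0" "p \<in> gen_ideal G"
  shows "h p = 0"
  using assms(3)
  by induction (simp_all add: assms(2) ring_map_zero[OF assms(1)] ring_map_add[OF assms(1)]
      ring_map_mult[OF assms(1)])

subsection \<open>Twisting by powers of a linear factor\<close>

definition map_fps :: "('a \<Rightarrow> 'b) \<Rightarrow> 'a fps \<Rightarrow> 'b fps" where
  "map_fps h f = Abs_fps (\<lambda>n. h (fps_nth f n))"

lemma map_fps_nth [simp]: "fps_nth (map_fps h f) n = h (fps_nth f n)"
  by (simp add: map_fps_def)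

lemma ring_map_map_fps: "ring_map h \<Longrightarrow> ring_map (map_fps h)"
  by (auto simp: ring_map_def fps_eq_iff fps_mult_nth ring_map_sum[unfolded ring_map_def]
      ring_map_zero[unfolded ring_map_def])

(* The expansion of (w - z)^\<alpha> in powers of z, where w stands for v^st and v^e for w^\<alpha>. *)
definition twist :: "int \<Rightarrow> complex \<Rightarrow> int \<Rightarrow> (int \<Rightarrow>\<^sub>0 'v cpoly) fps" where
  "twist st \<alpha> e = Abs_fps (\<lambda>i. Poly_Mapping.single (e - st * int i) (const ((-1) ^ i * (\<alpha> gchoose i))))"

text \<open>Both factors are binomial series, so this is Vandermonde's identity. Keeping e apart
  from \<alpha> permits fractional \<alpha> while the exponents of v remain integers.\<close>

lemma twist_mult: "twist st \<alpha> e * twist st \<beta> f = twist st (\<alpha> + \<beta>) (e + f)"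
proof (rule fps_ext)
  fix n
  have "fps_nth (twist st \<alpha> e * twist st \<beta> f) n =
      (\<Sum>i=0..n. Poly_Mapping.single (e + f - st * int n)
        (const ((-1) ^ n * ((\<alpha> gchoose i) * (\<beta> gchoose (n - i))))))"
    unfolding fps_mult_nth
  proof (rule sum.cong)
    fix i assume i: "i \<in> {0..n}"
    then have "e - st * int i + (f - st * int (n - i)) = e + f - st * int n"
      by (simp add: algebra_simps of_nat_diff)
    moreover have "(-1 :: complex) ^ i * (-1) ^ (n - i) = (-1) ^ n"
      using i by (simp flip: power_add)
    then have "(-1) ^ i * (\<alpha> gchoose i) * ((-1) ^ (n - i) * (\<beta> gchoose (n - i))) =
        (-1) ^ n * ((\<alpha> gchoose i) * (\<beta> gchoose (n - i)))"
      by (metis (no_types, opaque_lifting) mult.assoc mult.left_commute)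
    ultimately show "fps_nth (twist st \<alpha> e) i * fps_nth (twist st \<beta> f) (n - i) =
        Poly_Mapping.single (e + f - st * int n)
          (const ((-1) ^ n * ((\<alpha> gchoose i) * (\<beta> gchoose (n - i)))))"
      by (simp only: twist_def fps_nth_Abs_fps mult_single const_mult[symmetric])
  qed simp
  also have "\<dots> = Poly_Mapping.single (e + f - st * int n)
      (const ((-1) ^ n * (\<Sum>i=0..n. (\<alpha> gchoose i) * (\<beta> gchoose (n - i)))))"
    by (simp add: sum_distrib_left ring_map_sum[OF ring_map_const])
      (rule poly_mapping_eqI, simp add: lookup_sum_pm lookup_single when_def)
  also have "\<dots> = fps_nth (twist st (\<alpha> + \<beta>) (e + f)) n"
    by (simp add: twist_def gbinomial_Vandermonde)
  finally show "fps_nth (twist st \<alpha> e * twist st \<beta> f) n = fps_nth (twist st (\<alpha> + \<beta>) (e + f)) n" .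
qed

lemma twist_zero: "twist st 0 0 = 1"
  by (rule fps_ext) (auto simp: twist_def gbinomial_0_left)

lemma twist_power: "twist st \<alpha> e ^ k = twist st (of_nat k * \<alpha>) (int k * e)"
  by (induction k) (simp_all add: twist_zero twist_mult algebra_simps)

text \<open>For the pair (u, N) this is the coefficient of z^N in (v - z)^(\<sigma>(l-1-u)) x_u(z);
  the integer keys are exponents of v.\<close>

definition theta_var :: "int \<Rightarrow> nat \<Rightarrow> nat \<times> nat \<Rightarrow> int \<Rightarrow>\<^sub>0 (nat \<times> nat) cpoly" where
  "theta_var \<sigma> l v = (\<Sum>i\<le>snd v. Poly_Mapping.single (\<sigma> * (int l - 1 - int (fst v)) - int i)
     (const ((-1) ^ i * (of_int (\<sigma> * (int l - 1 - int (fst v))) gchoose i)) * var (fst v, snd v - i)))"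

(* For \<sigma> = 1 or -1, the substitution x_u(z) := (v - z)^(\<sigma>(l-1-u)) x_u(z), expanded for |v| > |z|. *)
definition theta :: "int \<Rightarrow> nat \<Rightarrow> (nat \<times> nat) cpoly \<Rightarrow> int \<Rightarrow>\<^sub>0 (nat \<times> nat) cpoly" where
  "theta \<sigma> l = poly_eval (\<lambda>c. Poly_Mapping.single 0 (const c)) (theta_var \<sigma> l)"

lemma ring_map_single_const: "ring_map (\<lambda>c. Poly_Mapping.single (0::int) (const c))"
  by (rule ring_map_comp[OF ring_map_single ring_map_const])

lemma ring_map_theta: "ring_map (theta \<sigma> l)"
  unfolding theta_def by (rule ring_map_poly_eval[OF ring_map_single_const])

lemma theta_const: "theta \<sigma> l (const c) = Poly_Mapping.single 0 (const c)"
  unfolding theta_def by (rule poly_eval_const[OF ring_map_single_const])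

lemma theta_var_eq: "theta \<sigma> l (var v) = theta_var \<sigma> l v"
  unfolding theta_def by (rule poly_eval_var[OF ring_map_single_const])

lemma ring_map_nu: "ring_map (nu L)"
  unfolding nu_def by (rule ring_map_subst_hom)

lemma map_fps_nu_x_ser: "map_fps (nu L) (x_ser u) = a_ser ^ (L - u) * b_ser ^ u"
  by (rule fps_ext) (simp add: x_ser_def nu_var)

text \<open>Besides \<open>nu\<close> on the coefficients, v is replaced by the L-th power of the
  Laurent variable, so that v has an L-th root in the target.\<close>

definition nu_laurent :: "nat \<Rightarrow> (int \<Rightarrow>\<^sub>0 (nat \<times> nat) cpoly) \<Rightarrow> int \<Rightarrow>\<^sub>0 ab_var cpoly" where
  "nu_laurent L = pm_lift (\<lambda>r. Poly_Mapping.single 0 (nu L r)) (\<lambda>j. Poly_Mapping.single (int L * j) 1)"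

lemma ring_map_single_nu: "ring_map (\<lambda>r. Poly_Mapping.single (0::int) (nu L r))"
  by (rule ring_map_comp[OF ring_map_single ring_map_nu])

lemma ring_map_nu_laurent: "ring_map (nu_laurent L)"
  unfolding nu_laurent_def
  by (rule ring_map_pm_lift[OF ring_map_single_nu]) (auto simp: mult_single algebra_simps)

lemma nu_laurent_single:
  "nu_laurent L (Poly_Mapping.single j r) = Poly_Mapping.single (int L * j) (nu L r)"
  by (simp add: nu_laurent_def pm_lift_single[OF ring_map_single_nu] mult_single)

text \<open>Multiplication of exponents by the positive number L is injective, so distinct
  coefficients do not mix.\<close>

lemma lookup_nu_laurent:
  assumes "L \<ge> 1"
  shows "Poly_Mapping.lookup (nu_laurent L p) (int L * j) = nu L (Poly_Mapping.lookup p j)"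
proof -
  have "Poly_Mapping.lookup (nu_laurent L p) (int L * j) =
      (\<Sum>k\<in>Poly_Mapping.keys p. if j = k then nu L (Poly_Mapping.lookup p k) else 0)"
    using assms by (auto simp: nu_laurent_def pm_lift_def lookup_sum_pm mult_single lookup_single when_def
        intro!: sum.cong)
  then show ?thesis
    by (auto simp: sum.delta in_keys_iff ring_map_zero[OF ring_map_nu])
qed

(* The twist is induced by a twist of a(t) and b(t) by L-th roots of powers of the linear factor. *)
definition theta_ab :: "nat \<Rightarrow> int \<Rightarrow> nat \<Rightarrow> ab_var cpoly \<Rightarrow> int \<Rightarrow>\<^sub>0 ab_var cpoly" where
  "theta_ab L \<sigma> l = poly_eval (\<lambda>c. Poly_Mapping.single 0 (const c))
    (\<lambda>v. case v of
        A n \<Rightarrow> fps_nth (twist (int L) (of_int (\<sigma> * (int l - 1)) / of_nat L) (\<sigma> * (int l - 1)) *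
                 map_fps (Poly_Mapping.single 0) a_ser) n
      | B n \<Rightarrow> fps_nth (twist (int L) (of_int (\<sigma> * (int l - 1 - int L)) / of_nat L) (\<sigma> * (int l - 1 - int L)) *
                 map_fps (Poly_Mapping.single 0) b_ser) n)"

lemma ring_map_theta_ab: "ring_map (theta_ab L \<sigma> l)"
  unfolding theta_ab_def by (rule ring_map_poly_eval[OF ring_map_single_const])

text \<open>It suffices to compare variables. There the roots combine: a^(L-u) b^u receives the
  exponent \<sigma>((L-u)(l-1) + u(l-1-L))/L = \<sigma>(l-1-u), which is that of the twist of
  x_u.\<close>

lemma theta_ab_nu:
  assumes "L \<ge> 1" "f \<in> polys_in ({0..L} \<times> UNIV)"
  shows "theta_ab L \<sigma> l (nu L f) = nu_laurent L (theta \<sigma> l f)"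
  using assms(2)
proof (rule ring_map_eq_on_polys[where g = "\<lambda>f. theta_ab L \<sigma> l (nu L f)"])
  show "ring_map (\<lambda>f. theta_ab L \<sigma> l (nu L f))"
    by (rule ring_map_comp[OF ring_map_theta_ab ring_map_nu])
  show "ring_map (\<lambda>f. nu_laurent L (theta \<sigma> l f))"
    by (rule ring_map_comp[OF ring_map_nu_laurent ring_map_theta])
  show "theta_ab L \<sigma> l (nu L (const c)) = nu_laurent L (theta \<sigma> l (const c))" for c
    by (simp add: nu_const theta_const nu_laurent_single theta_ab_def
        poly_eval_const[OF ring_map_single_const])
  fix v :: "nat \<times> nat" assume "v \<in> {0..L} \<times> UNIV"
  then obtain u N where v: "v = (u, N)" and u: "u \<le> L" by auto
  let ?s = "map_fps (Poly_Mapping.single (0::int)) :: ab_var cpoly fps \<Rightarrow> _"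
  let ?p = "\<sigma> * (int l - 1)" and ?q = "\<sigma> * (int l - 1 - int L)" and ?e = "\<sigma> * (int l - 1 - int u)"
  have s: "ring_map ?s" by (rule ring_map_map_fps[OF ring_map_single])
  have t: "ring_map (map_fps (theta_ab L \<sigma> l))" by (rule ring_map_map_fps[OF ring_map_theta_ab])
  have a: "map_fps (theta_ab L \<sigma> l) a_ser = twist (int L) (of_int ?p / of_nat L) ?p * ?s a_ser"
    by (rule fps_ext) (simp add: a_ser_def theta_ab_def poly_eval_var[OF ring_map_single_const])
  have b: "map_fps (theta_ab L \<sigma> l) b_ser = twist (int L) (of_int ?q / of_nat L) ?q * ?s b_ser"
    by (rule fps_ext) (simp add: b_ser_def theta_ab_def poly_eval_var[OF ring_map_single_const])
  have e1: "int (L - u) * ?p + int u * ?q = int L * ?e"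
    using u by (simp add: of_nat_diff algebra_simps)
  have "of_nat (L - u) * (of_int ?p / of_nat L) + of_nat u * (of_int ?q / of_nat L) =
      (of_int (int (L - u) * ?p + int u * ?q) / of_nat L :: complex)"
    by (simp add: add_divide_distrib)
  also have "\<dots> = of_int ?e" using assms(1) unfolding e1 by simp
  finally have e2: "of_nat (L - u) * (of_int ?p / of_nat L) + of_nat u * (of_int ?q / of_nat L) =
      (of_int ?e :: complex)" .
  have "theta_ab L \<sigma> l (nu L (var v)) =
      fps_nth (map_fps (theta_ab L \<sigma> l) (a_ser ^ (L - u) * b_ser ^ u)) N"
    by (simp add: v nu_var)
  also have "map_fps (theta_ab L \<sigma> l) (a_ser ^ (L - u) * b_ser ^ u) =
     (twist (int L) (of_int ?p / of_nat L) ?p * ?s a_ser) ^ (L - u) *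
     (twist (int L) (of_int ?q / of_nat L) ?q * ?s b_ser) ^ u"
    by (simp only: ring_map_mult[OF t] ring_map_power[OF t] a b)
  also have "\<dots> = (twist (int L) (of_int ?p / of_nat L) ?p ^ (L - u) *
      twist (int L) (of_int ?q / of_nat L) ?q ^ u) * ?s (a_ser ^ (L - u) * b_ser ^ u)"
    by (simp only: ring_map_mult[OF s] ring_map_power[OF s] power_mult_distrib mult_ac)
  also have "twist (int L) (of_int ?p / of_nat L) ?p ^ (L - u) *
      twist (int L) (of_int ?q / of_nat L) ?q ^ u = twist (int L) (of_int ?e) (int L * ?e)"
    by (simp only: twist_power twist_mult e1 e2)
  also have "fps_nth (\<dots> * ?s (a_ser ^ (L - u) * b_ser ^ u)) N =
      (\<Sum>i\<le>N. Poly_Mapping.single (int L * (?e - int i))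
        (const ((-1) ^ i * (of_int ?e gchoose i)) * nu L (var (u, N - i))))"
    unfolding fps_mult_nth atLeast0AtMost
    by (rule sum.cong) (simp_all add: twist_def mult_single nu_var right_diff_distrib)
  also have "\<dots> = nu_laurent L (theta \<sigma> l (var v))"
    by (simp add: theta_var_eq theta_var_def v ring_map_sum[OF ring_map_nu_laurent]
        nu_laurent_single ring_map_mult[OF ring_map_nu] nu_const)
  finally show "theta_ab L \<sigma> l (nu L (var v)) = nu_laurent L (theta \<sigma> l (var v))" .
qed

text \<open>\<open>theta_ab\<close> sends \<open>nu L f = 0\<close> to zero, and by
  \<open>theta_ab_nu\<close> this is the image of the twisted polynomial, whose coefficients can be
  read off one by one.\<close>

lemma nu_theta_eq_0:
  assumes "L \<ge> 1" "f \<in> polys_in ({0..L} \<times> UNIV)" "nu L f = 0"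
  shows "nu L (Poly_Mapping.lookup (theta \<sigma> l f) j) = 0"
proof -
  have "nu_laurent L (theta \<sigma> l f) = 0"
    using theta_ab_nu[OF assms(1,2), of \<sigma> l] by (simp add: assms(3) ring_map_zero[OF ring_map_theta_ab])
  then show ?thesis
    using lookup_nu_laurent[OF assms(1), of "theta \<sigma> l f" j] by simp
qed

subsection \<open>Laurent expansions\<close>

definition to_fls :: "(int \<Rightarrow>\<^sub>0 'c::comm_ring_1) \<Rightarrow> 'c fls" where
  "to_fls = pm_lift fls_const fls_X_intpow"

lemma ring_map_to_fls: "ring_map to_fls"
  unfolding to_fls_def
  by (rule ring_map_pm_lift[OF ring_map_fls_const])
    (auto simp only: fls_X_intpow_times_fls_X_intpow minus_zero fls_shift_0)

lemma fls_shift_one_mult: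
  "fls_shift m 1 * f = fls_shift m (f :: 'a::comm_ring_1 fls)"
  "f * fls_shift m 1 = fls_shift m (f :: 'a::comm_ring_1 fls)"
  using fls_X_intpow_times_conv_shift[where i = "-m" and f = f] by simp_all

lemma to_fls_nth [simp]: "fls_nth (to_fls p) j = Poly_Mapping.lookup p j"
  by (auto simp: to_fls_def pm_lift_def fls_nth_sum fls_X_intpow_times_conv_shift sum.delta in_keys_iff
      cong: if_cong)

section \<open>The twist as a polynomial in \<xi>(v)\<close>

definition xi_tail :: "nat \<Rightarrow> nat \<Rightarrow> (nat \<times> nat) cpoly fps" where
  "xi_tail l N = Abs_fps (\<lambda>i. var (l, N + 1 + i))"

text \<open>The coefficient of z^N in (v - z)^(-1) \<xi>(z) is v^(-1-N) times the truncation of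
  \<xi>(v) after v^N. That truncation is \<xi>(v) - v^(N+1) \<open>xi_tail l N\<close>, whence the
  linear polynomial.\<close>

definition phi_var :: "nat \<Rightarrow> nat \<times> nat \<Rightarrow> (nat \<times> nat) cpoly fls poly" where
  "phi_var l v = (if fst v = l then [:- fps_to_fls (xi_tail l (snd v)), fls_X_intpow (- 1 - int (snd v)):]
     else [:to_fls (theta_var 1 l v):])"

(* theta 1 l with the occurrences of x_l(v) made visible as the variable of a polynomial. *)
definition phi :: "nat \<Rightarrow> (nat \<times> nat) cpoly \<Rightarrow> (nat \<times> nat) cpoly fls poly" where
  "phi l = poly_eval (\<lambda>c. [:fls_const (const c):]) (phi_var l)"

text \<open>The difference quotient (p(\<xi>(v)) - p(0)) / \<xi>(v) for p = \<open>phi l f\<close>,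
  formed by a shift of coefficients so that nothing has to be divided by a series.\<close>

definition xi_quot :: "nat \<Rightarrow> (nat \<times> nat) cpoly \<Rightarrow> (nat \<times> nat) cpoly fls" where
  "xi_quot l f = poly (poly_shift 1 (phi l f)) (fps_to_fls (x_ser l))"

definition xi_res :: "nat \<Rightarrow> nat \<Rightarrow> (nat \<times> nat) cpoly \<Rightarrow> (nat \<times> nat) cpoly" where
  "xi_res l K f = fls_nth (xi_quot l f) (- 1 - int K)"

lemma ring_map_pCons_const: "ring_map (\<lambda>c. [:fls_const (const c :: (nat \<times> nat) cpoly):])"
proof -
  have "ring_map (\<lambda>c :: (nat \<times> nat) cpoly fls. [:c:])" by (simp add: ring_map_def)
  from ring_map_comp[OF this ring_map_comp[OF ring_map_fls_const ring_map_const]]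
  show ?thesis .
qed

lemma ring_map_phi: "ring_map (phi l)"
  unfolding phi_def by (rule ring_map_poly_eval[OF ring_map_pCons_const])

lemma phi_const: "phi l (const c) = [:fls_const (const c):]"
  unfolding phi_def by (rule poly_eval_const[OF ring_map_pCons_const])

lemma phi_var_eq: "phi l (var v) = phi_var l v"
  unfolding phi_def by (rule poly_eval_var[OF ring_map_pCons_const])

lemma pCons_coeff_0_poly_shift: "p = pCons (coeff p 0) (poly_shift 1 p)"
  by (rule poly_eqI) (simp add: coeff_pCons coeff_poly_shift split: nat.split)

lemma poly_shift_Suc_0_pCons [simp]: "poly_shift (Suc 0) (pCons a q) = q"
  by (rule poly_eqI) (simp add: coeff_poly_shift)

text \<open>With p = a + X p' and q = b + X q' one has pq - ab = X (p' q + a q'), a Leibniz rule for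
  the difference quotient. It gives the recursions of \<open>xi_quot\<close> along products with
  variables.\<close>

lemma poly_shift_1_mult:
  fixes p q :: "'a::comm_ring_1 poly"
  shows "poly (poly_shift 1 (p * q)) x =
    poly (poly_shift 1 p) x * poly q x + coeff p 0 * poly (poly_shift 1 q) x"
proof -
  obtain a p' b q' where p: "p = pCons a p'" and q: "q = pCons b q'"
    by (metis pCons_coeff_0_poly_shift)
  have "p * q = pCons (a * b) (smult a q' + p' * pCons b q')"
    by (simp add: p q)
  then have "poly_shift 1 (p * q) = smult a q' + p' * q"
    by (simp only: One_nat_def poly_shift_Suc_0_pCons q)
  then show ?thesis by (simp add: p q algebra_simps)
qed

lemma poly_phi: "poly (phi l f) (fps_to_fls (x_ser l)) = to_fls (theta 1 l f)"
proof (rule ring_map_eq_on_polys[where g = "\<lambda>f. poly (phi l f) (fps_to_fls (x_ser l))" and V = UNIV])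
  show "ring_map (\<lambda>f. poly (phi l f) (fps_to_fls (x_ser l)))"
    by (rule ring_map_comp[OF _ ring_map_phi]) (simp add: ring_map_def)
  show "ring_map (\<lambda>f. to_fls (theta 1 l f))"
    by (rule ring_map_comp[OF ring_map_to_fls ring_map_theta])
  show "poly (phi l (const c)) (fps_to_fls (x_ser l)) = to_fls (theta 1 l (const c))" for c
    by (rule fls_eqI) (simp add: phi_const theta_const lookup_single when_def)
  fix v :: "nat \<times> nat"
  obtain u N where v: "v = (u, N)" by fastforce
  show "poly (phi l (var v)) (fps_to_fls (x_ser l)) = to_fls (theta 1 l (var v))"
  proof (cases "u = l")
    case False
    then show ?thesis by (simp add: phi_var_eq phi_var_def v theta_var_eq)
  next
    case True
    \<comment> \<open>The expansion of (v - z)^(-1) is the geometric series.\<close>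
    have c: "(-1) ^ i * ((-1::complex) gchoose i) = 1" for i
      using gbinomial_minus[of "1::complex" i] by (simp flip: binomial_gbinomial power_mult_distrib)
    show ?thesis
    proof (rule fls_eqI)
      fix j :: int
      have "fls_nth (to_fls (theta 1 l (var v))) j =
          (\<Sum>i\<le>N. if j = - 1 - int i then var (l, N - i) else 0)"
        by (auto simp: theta_var_eq theta_var_def v True lookup_sum_pm lookup_single when_def c
            intro!: sum.cong)
      also have "\<dots> = (if j < 0 \<and> j + 1 + int N \<ge> 0 then var (l, nat (j + 1 + int N)) else 0)"
      proof (cases "j < 0 \<and> j + 1 + int N \<ge> 0")
        case True
        then have "(\<Sum>i\<le>N. if j = - 1 - int i then var (l, N - i) else 0) =
            (\<Sum>i\<le>N. if i = nat (- 1 - j) then var (l, nat (j + 1 + int N)) else (0 :: (nat \<times> nat) cpoly))"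
          by (intro sum.cong) (auto simp: nat_eq_iff intro!: arg_cong[where f = var])
        moreover have "nat (- 1 - j) \<le> N" using True by linarith
        ultimately show ?thesis using True by (simp add: sum.delta)
      next
        case False
        then have "(\<Sum>i\<le>N. if j = - 1 - int i then var (l, N - i) else (0 :: (nat \<times> nat) cpoly)) = 0"
          by (intro sum.neutral) auto
        then show ?thesis unfolding if_not_P[OF False] .
      qed
      also have "\<dots> = fls_nth (poly (phi l (var v)) (fps_to_fls (x_ser l))) j"
        by (auto simp: phi_var_eq phi_var_def v True fls_shift_one_mult xi_tail_def x_ser_def
            nat_add_distrib algebra_simps)
      finally show "fls_nth (poly (phi l (var v)) (fps_to_fls (x_ser l))) j =
          fls_nth (to_fls (theta 1 l (var v))) j" by simp
    qed
  qed
qed (rule polys_in_UNIV)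

lemma xi_quot_times_x_ser:
  "fps_to_fls (x_ser l) * xi_quot l f = to_fls (theta 1 l f) - coeff (phi l f) 0"
proof -
  have "poly (phi l f) (fps_to_fls (x_ser l)) = coeff (phi l f) 0 + fps_to_fls (x_ser l) * xi_quot l f"
    by (subst pCons_coeff_0_poly_shift[of "phi l f"]) (simp add: xi_quot_def)
  then show ?thesis by (simp add: poly_phi)
qed

lemma xi_quot_add: "xi_quot l (f + g) = xi_quot l f + xi_quot l g"
proof -
  have "poly_shift 1 (phi l f + phi l g) = poly_shift 1 (phi l f) + poly_shift 1 (phi l g)"
    by (rule poly_eqI) (simp add: coeff_poly_shift)
  then show ?thesis by (simp add: xi_quot_def ring_map_add[OF ring_map_phi])
qed

lemma xi_quot_const: "xi_quot l (const c) = 0"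
  by (simp add: xi_quot_def phi_const)

lemma xi_quot_var_mult:
  "xi_quot l (var (l, k) * f) = fls_X_intpow (- 1 - int k) * to_fls (theta 1 l f) -
     fps_to_fls (xi_tail l k) * xi_quot l f"
  unfolding xi_quot_def ring_map_mult[OF ring_map_phi] poly_shift_1_mult poly_phi
  by (simp add: phi_var_eq phi_var_def)

lemma xi_quot_other_var_mult:
  "u \<noteq> l \<Longrightarrow> xi_quot l (var (u, k) * f) = to_fls (theta_var 1 l (u, k)) * xi_quot l f"
  unfolding xi_quot_def ring_map_mult[OF ring_map_phi] poly_shift_1_mult poly_phi
  by (simp add: phi_var_eq phi_var_def)

subsection \<open>Degree in the last family of variables\<close>

text \<open>A filtration, not a grading: degree at most n in the x_l^(k), over the variables of
  lower index.\<close>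

inductive xdeg :: "nat \<Rightarrow> nat \<Rightarrow> (nat \<times> nat) cpoly \<Rightarrow> bool" for l where
  xdeg_base: "p \<in> polys_in ({..<l} \<times> UNIV) \<Longrightarrow> xdeg l n p"
| xdeg_add: "xdeg l n p \<Longrightarrow> xdeg l n q \<Longrightarrow> xdeg l n (p + q)"
| xdeg_var: "xdeg l n p \<Longrightarrow> xdeg l (Suc n) (var (l, k) * p)"

lemma xdeg_zero: "xdeg l n 0"
  by (rule xdeg_base[OF zero_in_polys])

lemma xdeg_mult_base:
  assumes "p \<in> polys_in ({..<l} \<times> UNIV)" "xdeg l b q"
  shows "xdeg l b (p * q)"
  using assms(2)
proof induction
  case (xdeg_var n q k)
  then show ?case using xdeg.xdeg_var[of l n "p * q" k] by (simp add: mult.left_commute)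
qed (auto simp: distrib_left intro: xdeg.intros mult_in_polys[OF assms(1)])

lemma xdeg_mono: "xdeg l n p \<Longrightarrow> n \<le> m \<Longrightarrow> xdeg l m p"
proof (induction arbitrary: m rule: xdeg.induct)
  case (xdeg_var n p k)
  then obtain m' where "m = Suc m'" "n \<le> m'" by (cases m) auto
  then show ?case using xdeg_var by (auto intro: xdeg.intros)
qed (auto intro: xdeg.intros)

lemma xdeg_mult: "xdeg l a p \<Longrightarrow> xdeg l b q \<Longrightarrow> xdeg l (a + b) (p * q)"
proof (induction rule: xdeg.induct)
  case (xdeg_base p n)
  then show ?case by (intro xdeg_mono[OF xdeg_mult_base]) auto
next
  case (xdeg_var n p k)
  then show ?case using xdeg.xdeg_var[of l "n + b" "p * q" k] by (simp add: mult.assoc)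
qed (auto simp: distrib_right intro: xdeg.intros)

lemma xdeg_uminus: "xdeg l n p \<Longrightarrow> xdeg l n (- p)"
  using xdeg_mult_base[OF uminus_in_polys[OF one_in_polys], of l n p] by simp

lemma xdeg_diff: "xdeg l n p \<Longrightarrow> xdeg l n q \<Longrightarrow> xdeg l n (p - q)"
  using xdeg_add[of l n p "- q"] xdeg_uminus[of l n q] by simp

lemma xdeg_sum: "(\<And>i. i \<in> S \<Longrightarrow> xdeg l n (f i)) \<Longrightarrow> xdeg l n (sum f S)"
  by (induction S rule: infinite_finite_induct) (auto intro: xdeg_zero xdeg_add)

lemma xdeg_0D: "xdeg l n p \<Longrightarrow> n = 0 \<Longrightarrow> p \<in> polys_in ({..<l} \<times> UNIV)"
  by (induction rule: xdeg.induct) (auto intro: add_in_polys)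

lemma xdeg_in: "xdeg l n p \<Longrightarrow> p \<in> polys_in ({..<Suc l} \<times> UNIV)"
proof (induction rule: xdeg.induct)
  case (xdeg_base p n)
  then show ?case by (rule polys_in_mono[rotated]) auto
qed (auto intro: add_in_polys mult_in_polys var_in_polys)

lemma xdeg_single_var: "u \<le> l \<Longrightarrow> xdeg l (if u = l then 1 else 0) (var (u, N))"
  using xdeg_var[OF xdeg_base[OF one_in_polys], of l 0 N]
  by (auto intro!: xdeg_base var_in_polys)

lemma xdeg_ex:
  assumes "p \<in> polys_in ({..<Suc l} \<times> UNIV)" shows "\<exists>n. xdeg l n p"
  using assms
proof (induction rule: polys_in_induct)
  case (const c)
  then show ?case by (auto intro: xdeg_base const_in_polys)
next
  case (add p q)
  then obtain m n where "xdeg l m p" "xdeg l n q" by blast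
  then have "xdeg l (max m n) (p + q)" by (intro xdeg_add) (auto intro: xdeg_mono)
  then show ?case ..
next
  case (var v p)
  then obtain n where "xdeg l n p" by blast
  moreover obtain u N where v: "v = (u, N)" "u \<le> l" using var by auto
  ultimately have "xdeg l ((if u = l then 1 else 0) + n) (var v * p)"
    unfolding v(1) by (intro xdeg_mult xdeg_single_var)
  then show ?case ..
qed

section \<open>Coefficients of products, and the effect of the twist on the degree\<close>

lemma fls_mult_nth_in:
  fixes f g :: "'a::comm_ring_1 fls"
  assumes "0 \<in> S" "\<And>x y. x \<in> S \<Longrightarrow> y \<in> S \<Longrightarrow> x + y \<in> S"
    "\<And>i j. i + j = n \<Longrightarrow> fls_nth f i * fls_nth g j \<in> S"
  shows "fls_nth (f * g) n \<in> S"
proof -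
  have sums: "sum h T \<in> S" if "\<And>i. i \<in> T \<Longrightarrow> h i \<in> S" for h :: "int \<Rightarrow> 'a" and T
    using that by (induction T rule: infinite_finite_induct) (auto intro: assms(1,2))
  show ?thesis unfolding fls_times_nth(2) by (rule sums) (rule assms(3), simp)
qed

text \<open>The range of summation depends on M alone and not on subdegrees, so that the recursions
  below can be summed over K.\<close>

lemma fps_to_fls_mult_nth:
  fixes h :: "'a::comm_ring_1 fls"
  assumes "\<And>i. i > M \<Longrightarrow> fls_nth h (j - int i) = 0"
  shows "fls_nth (fps_to_fls g * h) j = (\<Sum>i\<le>M. fps_nth g i * fls_nth h (j - int i))"
proof -
  let ?t = "\<lambda>i. fls_nth (fps_to_fls g) i * fls_nth h (j - i)"
  let ?S = "{fls_subdegree (fps_to_fls g)..j - fls_subdegree h}"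
  have "fls_nth (fps_to_fls g * h) j = sum ?t ?S"
    by (rule fls_times_nth(2))
  also have "\<dots> = sum ?t (?S \<union> {0..int M})"
  proof (rule sum.mono_neutral_left)
    show "\<forall>i\<in>?S \<union> {0..int M} - ?S. ?t i = 0"
    proof
      fix i assume "i \<in> ?S \<union> {0..int M} - ?S"
      then have "i < fls_subdegree (fps_to_fls g) \<or> j - i < fls_subdegree h" by auto
      then show "?t i = 0"
        using fls_eq0_below_subdegree[of i "fps_to_fls g"] fls_eq0_below_subdegree[of "j - i" h]
        by (metis mult_zero_left mult_zero_right)
    qed
  qed auto
  also have "\<dots> = sum ?t {0..int M}"
  proof (rule sum.mono_neutral_right)
    show "\<forall>i\<in>?S \<union> {0..int M} - {0..int M}. ?t i = 0"
    proof
      fix i assume "i \<in> ?S \<union> {0..int M} - {0..int M}"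
      then have "i < 0 \<or> i > int M" by auto
      then show "?t i = 0"
      proof
        assume "i > int M"
        then show ?thesis using assms[of "nat i"] by simp
      qed simp
    qed
  qed auto
  also have "\<dots> = (\<Sum>i\<le>M. ?t (int i))"
    by (rule sum.reindex_bij_witness[of _ int nat]) auto
  finally show ?thesis by simp
qed

lemma lookup_mult_to_fls:
  "Poly_Mapping.lookup (p * q) j = fls_nth (to_fls p * to_fls q) j"
  by (simp flip: ring_map_mult[OF ring_map_to_fls])

lemma theta_var_xdeg:
  assumes "u \<le> l"
  shows "xdeg l (if u = l then 1 else 0) (Poly_Mapping.lookup (theta_var \<sigma> l (u, N)) j)"
  unfolding theta_var_def lookup_sum_pm
proof (rule xdeg_sum)
  fix i
  show "xdeg l (if u = l then 1 else 0)
    (Poly_Mapping.lookup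
      (Poly_Mapping.single (\<sigma> * (int l - 1 - int (fst (u, N))) - int i)
        (const ((- 1) ^ i * (complex_of_int (\<sigma> * (int l - 1 - int (fst (u, N)))) gchoose i)) *
         var (fst (u, N), snd (u, N) - i))) j)"
    unfolding lookup_single when_def fst_conv snd_conv
    using xdeg_mult_base[OF const_in_polys xdeg_single_var[OF assms]] xdeg_zero by auto
qed

lemma theta_xdeg_mult:
  fixes p q :: "int \<Rightarrow>\<^sub>0 (nat \<times> nat) cpoly"
  assumes "\<And>i. xdeg l a (Poly_Mapping.lookup p i)" "\<And>i. xdeg l b (Poly_Mapping.lookup q i)"
  shows "xdeg l (a + b) (Poly_Mapping.lookup (p * q) j)"
  unfolding lookup_mult_to_fls
  using fls_mult_nth_in[of "{p. xdeg l (a + b) p}" j "to_fls p" "to_fls q"] assms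
  by (auto intro: xdeg_zero xdeg_add xdeg_mult)

text \<open>A twisted variable has as coefficients scalar multiples of variables with the same lower
  index, so the degree cannot rise.\<close>

lemma theta_xdeg: "xdeg l n f \<Longrightarrow> xdeg l n (Poly_Mapping.lookup (theta \<sigma> l f) j)"
proof (induction arbitrary: j rule: xdeg.induct)
  case (xdeg_base p n)
  have "xdeg l 0 (Poly_Mapping.lookup (theta \<sigma> l p) j)"
    using xdeg_base
  proof (induction arbitrary: j rule: polys_in_induct)
    case (const c)
    then show ?case
      by (auto simp: theta_const lookup_single when_def intro: xdeg.xdeg_base const_in_polys zero_in_polys)
  next
    case (add p q)
    then show ?case by (simp add: ring_map_add[OF ring_map_theta] lookup_add xdeg.xdeg_add)
  next
    case (var v p)
    then obtain u N where "v = (u, N)" "u < l" by auto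
    with var theta_var_xdeg[of u l \<sigma> N] show ?case
      using theta_xdeg_mult[of l 0 "theta_var \<sigma> l v" 0 "theta \<sigma> l p" j]
      by (simp add: ring_map_mult[OF ring_map_theta] theta_var_eq)
  qed
  then show ?case by (rule xdeg_mono) simp
next
  case (xdeg_add n p q)
  then show ?case by (simp add: ring_map_add[OF ring_map_theta] lookup_add xdeg.xdeg_add)
next
  case (xdeg_var n p k)
  then show ?case
    using theta_xdeg_mult[of l 1 "theta_var \<sigma> l (l, k)" n "theta \<sigma> l p" j] theta_var_xdeg[of l l \<sigma> k]
    by (simp add: ring_map_mult[OF ring_map_theta] theta_var_eq)
qed

subsection \<open>Residues at the last family of variables\<close>

lemma xi_res_add: "xi_res l K (f + g) = xi_res l K f + xi_res l K g"
  by (simp add: xi_res_def xi_quot_add)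

lemma xi_quot_base: "f \<in> polys_in ({..<l} \<times> UNIV) \<Longrightarrow> xi_quot l f = 0"
  by (induction rule: polys_in_induct) (auto simp: xi_quot_const xi_quot_add xi_quot_other_var_mult)

lemma xi_res_base: "f \<in> polys_in ({..<l} \<times> UNIV) \<Longrightarrow> xi_res l K f = 0"
  by (simp add: xi_res_def xi_quot_base)

lemma xi_res_bound: "\<exists>M. \<forall>K\<ge>M. xi_res l K f = 0"
proof (intro exI allI impI)
  fix K assume "nat (- fls_subdegree (xi_quot l f)) \<le> K"
  then show "xi_res l K f = 0"
    unfolding xi_res_def by (intro fls_eq0_below_subdegree) linarith
qed

text \<open>The first term comes from the product with v^(-1-k), which only shifts exponents; the
  sum is the convolution with the tail of \<xi>, finite because the pole order of the quotient is
  bounded by M.\<close>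

lemma xi_res_var_mult:
  assumes "\<And>K. K > M \<Longrightarrow> xi_res l K f = 0"
  shows "xi_res l K (var (l, k) * f) = Poly_Mapping.lookup (theta 1 l f) (int k - int K) -
    (\<Sum>i\<le>M. var (l, k + 1 + i) * xi_res l (K + i) f)"
proof -
  have "fls_nth (fps_to_fls (xi_tail l k) * xi_quot l f) (- 1 - int K) =
      (\<Sum>i\<le>M. fps_nth (xi_tail l k) i * fls_nth (xi_quot l f) (- 1 - int K - int i))"
  proof (rule fps_to_fls_mult_nth)
    fix i assume "i > M"
    then show "fls_nth (xi_quot l f) (- 1 - int K - int i) = 0"
      using assms[of "K + i"] by (simp add: xi_res_def algebra_simps)
  qed
  note tail = this
  show ?thesis
    unfolding xi_res_def xi_quot_var_mult fls_minus_nth tail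
    by (simp add: fls_shift_one_mult xi_tail_def algebra_simps)
qed

lemma xi_res_xdeg: "xdeg l n f \<Longrightarrow> xdeg l (n - 1) (xi_res l K f)"
proof (induction arbitrary: K rule: xdeg.induct)
  case (xdeg_base p n)
  then show ?case by (simp add: xi_res_base xdeg_zero)
next
  case (xdeg_add n p q)
  then show ?case by (simp add: xi_res_add xdeg.xdeg_add)
next
  case (xdeg_var n p k)
  obtain M where M: "\<And>K. K \<ge> M \<Longrightarrow> xi_res l K p = 0" using xi_res_bound by blast
  \<comment> \<open>If n = 0 the subtraction n - 1 is truncated, but then the residue
    vanishes.\<close>
  have "xdeg l n (var (l, k + 1 + i) * xi_res l (K + i) p)" for i
  proof (cases n)
    case 0
    then show ?thesis using xdeg_0D[OF xdeg_var.hyps] by (simp add: xi_res_base xdeg_zero)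
  next
    case (Suc m)
    then show ?thesis using xdeg.xdeg_var[OF xdeg_var.IH] by simp
  qed
  then show ?case
    using M by (subst xi_res_var_mult[of M])
      (auto intro!: xdeg_diff xdeg_sum theta_xdeg xdeg_var.hyps)
qed

lemma fls_nonneg_mult:
  fixes f g :: "'a::comm_ring_1 fls"
  assumes "\<And>j. j < 0 \<Longrightarrow> fls_nth f j = 0" "\<And>j. j < 0 \<Longrightarrow> fls_nth g j = 0" "j < 0"
  shows "fls_nth (f * g) j = 0"
proof -
  have "fls_nth f a * fls_nth g b = 0" if "a + b = j" for a b
    using that assms(1)[of a] assms(2)[of b] assms(3) by (cases "a < 0") auto
  then show ?thesis using fls_mult_nth_in[of "{0}" j f g] by auto
qed

text \<open>For u < l the exponent l-1-u is a natural number, so the binomial expansion stops before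
  negative powers of v.\<close>

lemma theta_var_nonneg:
  assumes "u < l" "j < 0"
  shows "Poly_Mapping.lookup (theta_var 1 l (u, N)) j = 0"
  unfolding theta_var_def lookup_sum_pm
proof (rule sum.neutral, rule ballI)
  fix i
  have "complex_of_int (1 * (int l - 1 - int u)) = of_nat (l - 1 - u)"
    using assms(1) by (simp add: of_nat_diff)
  then have "complex_of_int (1 * (int l - 1 - int u)) gchoose i = 0" if "i > l - 1 - u"
    using that by (simp flip: binomial_gbinomial)
  then show "Poly_Mapping.lookup
      (Poly_Mapping.single (1 * (int l - 1 - int (fst (u, N))) - int i)
        (const ((- 1) ^ i * (complex_of_int (1 * (int l - 1 - int (fst (u, N)))) gchoose i)) *
         var (fst (u, N), snd (u, N) - i))) j = 0"
    using assms by (cases "i > l - 1 - u") (auto simp: lookup_single when_def)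
qed

lemma coeff_phi_nonneg:
  assumes "f \<in> polys_in ({..<Suc l} \<times> UNIV)" "j < 0"
  shows "fls_nth (coeff (phi l f) 0) j = 0"
  using assms
proof (induction arbitrary: j rule: polys_in_induct)
  case (const c)
  then show ?case by (simp add: phi_const)
next
  case (add p q)
  then show ?case by (simp add: ring_map_add[OF ring_map_phi])
next
  case (var v p)
  then obtain u N where v: "v = (u, N)" "u \<le> l" by auto
  have "fls_nth (coeff (phi_var l v) 0) i = 0" if "i < 0" for i
    using that v theta_var_nonneg[of u l i N] by (auto simp: phi_var_def)
  from fls_nonneg_mult[OF this var.IH \<open>j < 0\<close>] show ?case
    by (simp add: ring_map_mult[OF ring_map_phi] phi_var_eq coeff_mult)
qed

text \<open>The part of \<open>phi l f\<close> free of \<xi>(v) has no pole, so in negative degrees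
  \<xi>(v) times the quotient is the twist itself.\<close>

lemma x_ser_times_xi_res:
  assumes "f \<in> polys_in ({..<Suc l} \<times> UNIV)" "\<And>K. K > M \<Longrightarrow> xi_res l K f = 0"
  shows "(\<Sum>i\<le>M. var (l, i) * xi_res l (K + i) f) = Poly_Mapping.lookup (theta 1 l f) (- 1 - int K)"
proof -
  have "fls_nth (fps_to_fls (x_ser l) * xi_quot l f) (- 1 - int K) =
      (\<Sum>i\<le>M. fps_nth (x_ser l) i * fls_nth (xi_quot l f) (- 1 - int K - int i))"
  proof (rule fps_to_fls_mult_nth)
    fix i assume "i > M"
    then show "fls_nth (xi_quot l f) (- 1 - int K - int i) = 0"
      using assms(2)[of "K + i"] by (simp add: xi_res_def algebra_simps)
  qed
  also have "\<dots> = (\<Sum>i\<le>M. var (l, i) * xi_res l (K + i) f)"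
    by (simp add: x_ser_def xi_res_def algebra_simps)
  finally show ?thesis
    using coeff_phi_nonneg[OF assms(1), of "- 1 - int K"] by (simp add: xi_quot_times_x_ser)
qed

section \<open>The target of \<open>nu\<close> as an integral domain\<close>

primrec ab_index :: "ab_var \<Rightarrow> nat" where
  "ab_index (A n) = 2 * n"
| "ab_index (B n) = 2 * n + 1"

lemma ab_index_inject: "ab_index v = ab_index w \<Longrightarrow> v = w"
  by (cases v; cases w; auto simp: Suc_double_not_eq_double double_not_eq_Suc_double)

text \<open>A linear order on the variables induces one on the monomials compatible with their
  product, and this makes the polynomial ring an integral domain.\<close>

instantiation ab_var :: linorder
begin

definition less_eq_ab_var :: "ab_var \<Rightarrow> ab_var \<Rightarrow> bool" where
  "less_eq_ab_var v w \<longleftrightarrow> ab_index v \<le> ab_index w"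

definition less_ab_var :: "ab_var \<Rightarrow> ab_var \<Rightarrow> bool" where
  "less_ab_var v w \<longleftrightarrow> ab_index v < ab_index w"

instance
  by intro_classes (unfold less_eq_ab_var_def less_ab_var_def, linarith+, metis ab_index_inject order.antisym, linarith)

end

lemma var_neq_0: "var v \<noteq> 0"
  using lookup_single_eq[of "Poly_Mapping.single v (1::nat)" "1::complex"]
  by (auto simp: var_def simp del: lookup_single_eq)

lemma nu_var_0_neq_0: "nu L (var (l, 0)) \<noteq> 0"
  by (simp add: nu_var a_ser_def b_ser_def fps_nth_power_0 var_neq_0)

text \<open>The products of \<xi>(v) with the residues are coefficients of the twist and lie in the
  kernel. These equations are triangular in K with x_l^(0) on the diagonal, whose image is nonzero
  in a domain; they are solved from large K downwards.\<close>

lemma nu_xi_res_eq_0: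
  assumes L: "L \<ge> 1" "l \<le> L" and f: "f \<in> polys_in ({..<Suc l} \<times> UNIV)" "nu L f = 0"
  shows "nu L (xi_res l K f) = 0"
proof -
  obtain M where M: "\<And>K. K \<ge> M \<Longrightarrow> xi_res l K f = 0" using xi_res_bound by blast
  have "f \<in> polys_in ({0..L} \<times> UNIV)"
    using f(1) L(2) by (rule_tac polys_in_mono[rotated]) auto
  note theta = nu_theta_eq_0[OF L(1) this f(2)]
  show ?thesis
  proof (induction "M - K" arbitrary: K rule: less_induct)
    case less
    show ?case
    proof (cases "K < M")
      case False
      then show ?thesis using M by (simp add: ring_map_zero[OF ring_map_nu])
    next
      case True
      have "0 = nu L (\<Sum>i\<le>M. var (l, i) * xi_res l (K + i) f)"
        using M by (subst x_ser_times_xi_res[OF f(1)]) (auto simp: theta)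
      also have "\<dots> = (\<Sum>i\<le>M. nu L (var (l, i)) * nu L (xi_res l (K + i) f))"
        by (simp add: ring_map_sum[OF ring_map_nu] ring_map_mult[OF ring_map_nu])
      also have "\<dots> = nu L (var (l, 0)) * nu L (xi_res l (K + 0) f) +
          (\<Sum>i\<in>{..M} - {0}. nu L (var (l, i)) * nu L (xi_res l (K + i) f))"
        by (rule sum.remove) auto
      \<comment> \<open>The terms with i > 0 involve residues of larger index, where the claim is
        known.\<close>
      also have "(\<Sum>i\<in>{..M} - {0}. nu L (var (l, i)) * nu L (xi_res l (K + i) f)) = 0"
        using less True by (intro sum.neutral) auto
      finally show ?thesis using nu_var_0_neq_0 by simp
    qed
  qed
qed

subsection \<open>Undoing the twist\<close>

lemma theta_var_as_fps:
  "Abs_fps (\<lambda>N. theta_var \<sigma> l (u, N)) =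
     twist 1 (of_int (\<sigma> * (int l - 1 - int u))) (\<sigma> * (int l - 1 - int u)) *
       map_fps (Poly_Mapping.single 0) (x_ser u)"
  by (rule fps_ext) (simp add: theta_var_def twist_def x_ser_def fps_mult_nth mult_single atLeast0AtMost)

definition untwist :: "nat \<Rightarrow> (nat \<times> nat) cpoly \<Rightarrow> (nat \<times> nat) cpoly fls" where
  "untwist l r = to_fls (theta (- 1) l r)"

lemma ring_map_untwist: "ring_map (untwist l)"
  unfolding untwist_def by (rule ring_map_comp[OF ring_map_to_fls ring_map_theta])

lemma to_fls_single: "to_fls (Poly_Mapping.single k c) = fls_const c * fls_X_intpow k"
  unfolding to_fls_def by (rule pm_lift_single[OF ring_map_fls_const])

lemma untwist_const: "untwist l (const c) = fls_const (const c)"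
  by (simp add: untwist_def theta_const to_fls_single)

text \<open>The exponents of the two twists add up to zero, so as series in z they cancel. Thus f is
  recovered by untwisting each coefficient of its twist and restoring the powers of v.\<close>

lemma untwist_theta: "pm_lift (untwist l) fls_X_intpow (theta 1 l f) = fls_const f"
proof (rule ring_map_eq_on_polys[where V = UNIV])
  let ?ext = "pm_lift (untwist l) fls_X_intpow"
  have ext: "ring_map ?ext"
    by (rule ring_map_pm_lift[OF ring_map_untwist])
      (auto simp only: fls_X_intpow_times_fls_X_intpow minus_zero fls_shift_0)
  show "ring_map (\<lambda>f. ?ext (theta 1 l f))"
    by (rule ring_map_comp[OF ext ring_map_theta])
  show "ring_map (fls_const :: (nat \<times> nat) cpoly \<Rightarrow> _)" by (rule ring_map_fls_const)
  show "?ext (theta 1 l (const c)) = fls_const (const c)" for c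
    by (simp add: theta_const pm_lift_single[OF ring_map_untwist] untwist_const)
  fix v :: "nat \<times> nat"
  obtain u N where v: "v = (u, N)" by fastforce
  let ?e = "int l - 1 - int u"
  let ?s = "map_fps (Poly_Mapping.single (0::int)) (x_ser u)"
  have "map_fps ?ext (Abs_fps (\<lambda>N. theta_var 1 l (u, N))) =
      map_fps ?ext (twist 1 (of_int ?e) ?e) * map_fps ?ext ?s"
    unfolding theta_var_as_fps by (simp add: ring_map_mult[OF ring_map_map_fps[OF ext]])
  also have "map_fps ?ext (twist 1 (of_int ?e) ?e) = map_fps to_fls (twist 1 (of_int ?e) ?e)"
    by (rule fps_ext) (simp add: twist_def pm_lift_single[OF ring_map_untwist] untwist_const to_fls_single)
  also have "map_fps ?ext ?s = map_fps to_fls (Abs_fps (\<lambda>N. theta_var (- 1) l (u, N)))"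
    by (rule fps_ext) (simp add: x_ser_def pm_lift_single[OF ring_map_untwist] untwist_def theta_var_eq)
  also have "\<dots> = map_fps to_fls (twist 1 (of_int (- ?e)) (- ?e)) * map_fps to_fls ?s"
    unfolding theta_var_as_fps by (simp add: ring_map_mult[OF ring_map_map_fps[OF ring_map_to_fls]])
  also have "map_fps to_fls (twist 1 (of_int ?e) ?e) * \<dots> =
      map_fps to_fls (twist 1 (of_int ?e) ?e * twist 1 (of_int (- ?e)) (- ?e)) * map_fps to_fls ?s"
    by (simp only: ring_map_mult[OF ring_map_map_fps[OF ring_map_to_fls]] mult.assoc)
  also have "twist 1 (of_int ?e) ?e * twist 1 (of_int (- ?e)) (- ?e) = (1 :: (int \<Rightarrow>\<^sub>0 (nat \<times> nat) cpoly) fps)"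
    unfolding twist_mult of_int_minus by (simp add: twist_zero)
  finally have "map_fps ?ext (Abs_fps (\<lambda>N. theta_var 1 l (u, N))) = map_fps to_fls ?s"
    by (simp add: ring_map_one[OF ring_map_map_fps[OF ring_map_to_fls]])
  from arg_cong[OF this, of "\<lambda>f. fps_nth f N"]
  show "?ext (theta 1 l (var v)) = fls_const (var v)"
    by (simp add: theta_var_eq v x_ser_def to_fls_single)
qed (rule polys_in_UNIV)

subsection \<open>Pairing with the last series modulo the quadratic relations\<close>

definition xi_pair :: "nat \<Rightarrow> (nat \<times> nat) cpoly fls \<Rightarrow> (nat \<times> nat) cpoly" where
  "xi_pair l g = fls_nth (fps_to_fls (x_ser l) * g) (- 1)"

lemma xi_pair_add: "xi_pair l (g + h) = xi_pair l g + xi_pair l h"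
  by (simp add: xi_pair_def distrib_left)

lemma xi_pair_diff: "xi_pair l (g - h) = xi_pair l g - xi_pair l h"
  by (simp add: xi_pair_def right_diff_distrib)

lemma xi_pair_zero: "xi_pair l 0 = 0"
  by (simp add: xi_pair_def)

lemma xi_pair_sum: "xi_pair l (sum g S) = (\<Sum>i\<in>S. xi_pair l (g i))"
  by (induction S rule: infinite_finite_induct) (auto simp: xi_pair_add xi_pair_zero)

lemma xi_pair_const_mult: "xi_pair l (fls_const c * g) = c * xi_pair l g"
  by (simp add: xi_pair_def mult.left_commute[of _ "fls_const c"])

lemma xi_pair_nonneg: "(\<And>j. j < 0 \<Longrightarrow> fls_nth g j = 0) \<Longrightarrow> xi_pair l g = 0"
  unfolding xi_pair_def by (rule fls_nonneg_mult) auto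

lemma xi_pair_intpow: "xi_pair l (fls_X_intpow (- 1 - int k) * fls_const f) = var (l, k) * f"
  by (simp add: mult.commute[of _ "fls_const f"] xi_pair_const_mult)
    (simp add: xi_pair_def fls_shift_one_mult x_ser_def)

(* p agrees modulo the quadratic relations with an element of degree at most n in the x_l^{(k)}. *)
definition mJ :: "nat \<Rightarrow> nat \<Rightarrow> (nat \<times> nat) cpoly \<Rightarrow> bool" where
  "mJ l n p \<longleftrightarrow> (\<exists>j\<in>gen_ideal (Q_gens l). xdeg l n (p - j))"

lemma mJ_xdeg: "xdeg l n p \<Longrightarrow> mJ l n p"
  unfolding mJ_def by (rule bexI[of _ 0]) (auto intro: gen_ideal_zero)

lemma mJ_zero: "mJ l n 0"
  by (rule mJ_xdeg[OF xdeg_zero])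

lemma mJ_add:
  assumes "mJ l n p" "mJ l n q" shows "mJ l n (p + q)"
proof -
  obtain i j where "i \<in> gen_ideal (Q_gens l)" "xdeg l n (p - i)" "j \<in> gen_ideal (Q_gens l)" "xdeg l n (q - j)"
    using assms unfolding mJ_def by blast
  then show ?thesis unfolding mJ_def
    by (intro bexI[of _ "i + j"] gen_ideal_add) (auto dest: xdeg_add simp: algebra_simps)
qed

lemma mJ_mult:
  assumes "mJ l a p" "xdeg l b q" shows "mJ l (a + b) (p * q)"
proof -
  obtain i where "i \<in> gen_ideal (Q_gens l)" "xdeg l a (p - i)"
    using assms unfolding mJ_def by blast
  then show ?thesis unfolding mJ_def
    by (intro bexI[of _ "q * i"] gen_ideal_mult) (auto dest: xdeg_mult[OF _ assms(2)] simp: algebra_simps)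
qed

lemma mJ_mult_base: "mJ l n p \<Longrightarrow> q \<in> polys_in ({..<l} \<times> UNIV) \<Longrightarrow> mJ l n (q * p)"
  using mJ_mult[of l n p 0 q] by (simp add: xdeg_base mult.commute)

lemma mJ_uminus: "mJ l n p \<Longrightarrow> mJ l n (- p)"
  using mJ_mult_base[of l n p "- 1", OF _ uminus_in_polys[OF one_in_polys]] by simp

lemma mJ_diff: "mJ l n p \<Longrightarrow> mJ l n q \<Longrightarrow> mJ l n (p - q)"
  using mJ_add[of l n p "- q"] mJ_uminus[of l n q] by simp

lemma mJ_sum: "(\<And>i. i \<in> S \<Longrightarrow> mJ l n (f i)) \<Longrightarrow> mJ l n (sum f S)"
  by (induction S rule: infinite_finite_induct) (auto intro: mJ_zero mJ_add)

lemma mJ_var: "mJ l (n - 1) p \<Longrightarrow> (n = 0 \<Longrightarrow> p = 0) \<Longrightarrow> mJ l n (var (l, k) * p)"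
  using mJ_mult[of l "n - 1" p 1 "var (l, k)"] xdeg_single_var[of l l k]
  by (cases n) (auto simp: mJ_zero mult.commute)

lemma x_ser_nth_in: "u < l \<Longrightarrow> fps_nth (x_ser u) i \<in> polys_in ({..<l} \<times> UNIV)"
  by (auto simp: x_ser_def intro: var_in_polys)

text \<open>In the relation \<open>Q_ser u l w\<close> only the summand of index u contains x_l; the
  others involve x_(u+1), ..., x_(l-1). So the relation expresses \<xi> times the w-th derivative of
  x_u through lower variables.\<close>

lemma x_ser_mult_deriv_mJ:
  assumes "u + 2 + w \<le> l"
  shows "mJ l 0 (fps_nth (x_ser l * (fps_deriv ^^ w) (x_ser u)) N)"
proof -
  define rest where "rest = (\<Sum>v = Suc u..l - 1. (-1) ^ v * of_nat ((l - u - 1) choose (v - u))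
                     * (fps_deriv ^^ w) (x_ser v) * x_ser (l + u - v))"
  have "Q_ser u l w = (-1) ^ u * (fps_deriv ^^ w) (x_ser u) * x_ser l + rest"
    unfolding Q_ser_def rest_def using assms by (subst sum.atLeast_Suc_atMost) auto
  then have "x_ser l * (fps_deriv ^^ w) (x_ser u) = Q_ser u l w - rest \<or>
      x_ser l * (fps_deriv ^^ w) (x_ser u) = - (Q_ser u l w - rest)"
    by (cases "even u") (auto simp: algebra_simps)
  moreover have "mJ l 0 (fps_nth (Q_ser u l w - rest) N)"
  proof -
    have "fps_nth (Q_ser u l w) N \<in> gen_ideal (Q_gens l)"
      unfolding Q_gens_def using assms
      by (intro gen_ideal_gen CollectI exI[of _ u] exI[of _ l] exI[of _ w] exI[of _ N]) auto
    moreover have "fps_nth rest N \<in> polys_in ({..<l} \<times> UNIV)"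
      unfolding rest_def using assms
      by (auto simp: fps_sum_nth intro!: sum_in_polys fps_nth_mult_in_polys[OF fps_nth_mult_in_polys]
          fps_sign_in_polys fps_deriv_in_polys x_ser_nth_in)
    ultimately show ?thesis
      unfolding mJ_def
      by (intro bexI[of _ "fps_nth (Q_ser u l w) N"]) (auto intro: xdeg_base uminus_in_polys)
  qed
  ultimately show ?thesis by (auto dest: mJ_uminus)
qed

text \<open>Poles in v are allowed only in factors b of derivatives of x_u(v) of order below e.
  Multiplied by \<xi>(v), such derivatives can be reduced by the quadratic relations if e is at most
  l-1-u.\<close>

inductive deriv_span :: "nat \<Rightarrow> nat \<Rightarrow> nat \<Rightarrow> (nat \<times> nat) cpoly fls \<Rightarrow> bool" for l u where
  deriv_span_fps: "(\<And>i. fps_nth p i \<in> polys_in ({..<l} \<times> UNIV)) \<Longrightarrow> deriv_span l u e (fps_to_fls p)"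
| deriv_span_deriv: "(\<And>i. fls_nth b i \<in> polys_in ({..<l} \<times> UNIV)) \<Longrightarrow> w < e \<Longrightarrow>
    deriv_span l u e (b * fps_to_fls ((fps_deriv ^^ w) (x_ser u)))"
| deriv_span_add: "deriv_span l u e g \<Longrightarrow> deriv_span l u e h \<Longrightarrow> deriv_span l u e (g + h)"

lemma of_int_in_polys: "of_int k \<in> polys_in V"
  by (cases k) (auto intro: of_nat_in_polys uminus_in_polys simp del: of_nat_Suc)

lemma deriv_span_fls_deriv: "deriv_span l u e g \<Longrightarrow> deriv_span l u (Suc e) (fls_deriv g)"
proof (induction rule: deriv_span.induct)
  case (deriv_span_fps p e)
  then show ?case
    unfolding fls_deriv_fps_to_fls
    by (intro deriv_span.deriv_span_fps)
      (auto simp del: of_nat_Suc intro!: mult_in_polys of_nat_in_polys)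
next
  case (deriv_span_deriv b w e)
  have eq: "fls_deriv (b * fps_to_fls ((fps_deriv ^^ w) (x_ser u))) =
      b * fps_to_fls ((fps_deriv ^^ Suc w) (x_ser u)) + fls_deriv b * fps_to_fls ((fps_deriv ^^ w) (x_ser u))"
    by (simp add: fls_deriv_fps_to_fls)
  have "fls_nth (fls_deriv b) i \<in> polys_in ({..<l} \<times> UNIV)" for i
    unfolding fls_deriv_nth by (intro mult_in_polys of_int_in_polys deriv_span_deriv)
  then show ?case
    unfolding eq using deriv_span_deriv
    by (intro deriv_span.deriv_span_add deriv_span.deriv_span_deriv) auto
next
  case (deriv_span_add e g h)
  then show ?case by (simp add: deriv_span.deriv_span_add)
qed

lemma deriv_span_const_mult: "deriv_span l u e g \<Longrightarrow> deriv_span l u e (fls_const (const c) * g)"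
proof (induction rule: deriv_span.induct)
  case (deriv_span_fps p e)
  have "deriv_span l u e (fps_to_fls (fps_const (const c) * p))"
    using deriv_span_fps by (intro deriv_span.deriv_span_fps) (auto intro: mult_in_polys const_in_polys)
  then show ?case by (simp add: fls_times_fps_to_fls)
next
  case (deriv_span_deriv b w e)
  then have "deriv_span l u e ((fls_const (const c) * b) * fps_to_fls ((fps_deriv ^^ w) (x_ser u)))"
    by (intro deriv_span.deriv_span_deriv) (auto intro: mult_in_polys const_in_polys)
  then show ?case by (simp add: mult.assoc)
next
  case (deriv_span_add e g h)
  then show ?case by (simp add: distrib_left deriv_span.deriv_span_add)
qed

text \<open>The coefficient of z^N in (v - z)^(-e) x_u(z). For e = l-1-u it is the untwisted
  variable x_u^(N).\<close>

definition pole :: "nat \<Rightarrow> nat \<Rightarrow> nat \<Rightarrow> (nat \<times> nat) cpoly fls" where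
  "pole e u N = (\<Sum>i\<le>N. fls_const (const ((-1) ^ i * ((- of_nat e) gchoose i)) * var (u, N - i)) *
     fls_X_intpow (- int e - int i))"

lemma pole_nth:
  "fls_nth (pole e u N) j =
     (\<Sum>i\<le>N. if j = - int e - int i then const ((-1) ^ i * ((- of_nat e) gchoose i)) * var (u, N - i) else 0)"
  by (auto simp: pole_def fls_nth_sum fls_shift_one_mult intro!: sum.cong)

lemma const_of_int: "(const (of_int k) :: 'v cpoly) = of_int k"
proof -
  have nat: "(const (of_nat n) :: 'v cpoly) = of_nat n" for n
    by (induction n) (simp_all add: const_add)
  have "(const (- c) :: 'v cpoly) = - const c" for c
    by (simp add: const_def single_uminus)
  then show ?thesis using nat by (cases k) (simp_all del: of_nat_Suc)
qed

lemma fls_deriv_pole: "fls_deriv (pole e u N) = fls_const (const (- of_nat e)) * pole (Suc e) u N"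
proof (rule fls_eqI)
  fix j
  have g: "of_int (- int e - int i) * ((- of_nat e :: complex) gchoose i) =
      - of_nat e * ((- of_nat (Suc e)) gchoose i)" for i
  proof -
    have "- of_nat e - 1 = (- of_nat (Suc e) :: complex)"
      "of_int (- int e - int i) = (- of_nat e - of_nat i :: complex)" by simp_all
    then show ?thesis using gbinomial_absorb_comp[of "- of_nat e :: complex" i] by (simp only:)
  qed
  have c: "of_int (- int e - int i) * const ((-1) ^ i * ((- of_nat e) gchoose i)) =
      const (- of_nat e) * const ((-1) ^ i * ((- of_nat (Suc e)) gchoose i))" for i
    unfolding const_of_int[symmetric] const_mult[symmetric]
    by (simp only: mult.left_commute[of _ "(-1) ^ i"] g)
  have "fls_nth (fls_deriv (pole e u N)) j =
      (\<Sum>i\<le>N. if j = - int (Suc e) - int i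
        then (of_int (- int e - int i) * const ((-1) ^ i * ((- of_nat e) gchoose i))) * var (u, N - i) else 0)"
    unfolding fls_deriv_nth pole_nth sum_distrib_left
    by (intro sum.cong) (auto simp: mult.assoc)
  also have "\<dots> = fls_nth (fls_const (const (- of_nat e)) * pole (Suc e) u N) j"
    unfolding c by (auto simp: pole_nth sum_distrib_left mult.assoc intro!: sum.cong)
  finally show "fls_nth (fls_deriv (pole e u N)) j = \<dots>" .
qed

lemma to_fls_theta_var_pole:
  assumes "\<sigma> * (int l - 1 - int u) = - int e"
  shows "to_fls (theta_var \<sigma> l (u, N)) = pole e u N"
  using assms unfolding theta_var_def pole_def ring_map_sum[OF ring_map_to_fls] to_fls_single
  by simp

text \<open>For e = 1 the geometric series gives v^(-1-N) x_u(v) minus a power series.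
  Differentiating in v raises e by one, and with it the order of the derivatives of x_u that
  occur.\<close>

lemma pole_deriv_span:
  assumes "u < l" shows "deriv_span l u e (pole e u N)"
proof (induction e)
  case 0
  have "pole 0 u N = (\<Sum>i\<le>N. if i = 0 then fls_const (var (u, N)) else 0)"
    unfolding pole_def by (intro sum.cong) (auto simp: gbinomial_0_left)
  also have "\<dots> = fps_to_fls (fps_const (var (u, N)))" by (simp add: sum.delta)
  finally have eq: "pole 0 u N = fps_to_fls (fps_const (var (u, N)))" .
  show ?case
    unfolding eq using assms
    by (intro deriv_span_fps) (auto intro: zero_in_polys var_in_polys)
next
  case (Suc e)
  show ?case
  proof (cases e)
    case 0
    \<comment> \<open>The twist with l = u has exponent -1 on x_u, so the splitting of
      \<open>phi\<close> applies with u in place of l.\<close>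
    have "pole 1 u N = to_fls (theta_var 1 u (u, N))"
      by (rule to_fls_theta_var_pole[symmetric]) simp
    also have "\<dots> = fps_to_fls (- xi_tail u N) + fls_X_intpow (- 1 - int N) * fps_to_fls ((fps_deriv ^^ 0) (x_ser u))"
      using poly_phi[of u "var (u, N)"] by (simp add: phi_var_eq phi_var_def theta_var_eq mult.commute)
    also have "deriv_span l u 1 \<dots>"
      using assms
      by (intro deriv_span_add deriv_span_fps deriv_span_deriv)
        (auto simp: xi_tail_def intro: uminus_in_polys var_in_polys zero_in_polys one_in_polys)
    finally show ?thesis using 0 by simp
  next
    case (Suc e')
    have "fls_const (const (- 1 / of_nat e)) * fls_deriv (pole e u N) =
        fls_const (const (- 1 / of_nat e * - of_nat e)) * pole (Suc e) u N"
      unfolding fls_deriv_pole const_mult by (simp flip: mult.assoc)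
    also have "\<dots> = pole (Suc e) u N" using Suc by (simp del: of_nat_Suc)
    finally have "pole (Suc e) u N = fls_const (const (- 1 / of_nat e)) * fls_deriv (pole e u N)" ..
    then show ?thesis
      using deriv_span_const_mult[OF deriv_span_fls_deriv[OF Suc.IH]] by simp
  qed
qed

text \<open>Quantifying over all power series p lets factors without a pole be absorbed, so that the
  property can be established factor by factor.\<close>

definition xi_ok :: "nat \<Rightarrow> nat \<Rightarrow> (nat \<times> nat) cpoly fls \<Rightarrow> bool" where
  "xi_ok l n g \<longleftrightarrow> (\<forall>j. xdeg l n (fls_nth g j)) \<and>
     (\<forall>p. (\<forall>i. fps_nth p i \<in> polys_in ({..<l} \<times> UNIV)) \<longrightarrow> mJ l n (xi_pair l (fps_to_fls p * g)))"

lemma xi_ok_pair: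
  "xi_ok l n g \<Longrightarrow> (\<And>i. fps_nth p i \<in> polys_in ({..<l} \<times> UNIV)) \<Longrightarrow>
    mJ l n (xi_pair l (fps_to_fls p * g))"
  by (simp add: xi_ok_def)

lemma fls_mult_base_xdeg:
  assumes "\<And>i. fls_nth b i \<in> polys_in ({..<l} \<times> UNIV)" "\<And>j. xdeg l n (fls_nth g j)"
  shows "xdeg l n (fls_nth (b * g) j)"
  using fls_mult_nth_in[of "{p. xdeg l n p}" j b g] assms
  by (auto intro: xdeg_zero xdeg_add xdeg_mult_base)

lemma fps_to_fls_nth_in:
  "(\<And>i. fps_nth p i \<in> polys_in V) \<Longrightarrow> fls_nth (fps_to_fls p) j \<in> polys_in V"
  by (auto intro: zero_in_polys)

lemma xi_ok_add: "xi_ok l n g \<Longrightarrow> xi_ok l n h \<Longrightarrow> xi_ok l n (g + h)"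
  by (auto simp: xi_ok_def distrib_left xi_pair_add intro: xdeg_add mJ_add)

text \<open>A power series factor is absorbed by the test series. For a derivative of x_u, its
  product with \<xi>(v) is congruent to lower variables coefficient by coefficient, so the degree
  stays n whatever poles b has.\<close>

lemma xi_ok_deriv_span_mult:
  assumes "deriv_span l u e y" "xi_ok l n g" "u + 1 + e \<le> l"
  shows "xi_ok l n (y * g)"
  using assms(1,3)
proof (induction rule: deriv_span.induct)
  case (deriv_span_fps q e)
  have "xdeg l n (fls_nth (fps_to_fls q * g) j)" for j
    using assms(2) deriv_span_fps by (intro fls_mult_base_xdeg fps_to_fls_nth_in) (auto simp: xi_ok_def)
  moreover have "mJ l n (xi_pair l (fps_to_fls p * (fps_to_fls q * g)))"
    if "\<And>i. fps_nth p i \<in> polys_in ({..<l} \<times> UNIV)" for p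
  proof -
    have "mJ l n (xi_pair l (fps_to_fls (p * q) * g))"
      using assms(2) fps_nth_mult_in_polys[OF that deriv_span_fps(1)] by (auto simp: xi_ok_def)
    then show ?thesis by (simp add: fls_times_fps_to_fls mult.assoc)
  qed
  ultimately show ?case by (auto simp: xi_ok_def)
next
  case (deriv_span_deriv b w e)
  let ?d = "(fps_deriv ^^ w) (x_ser u)"
  have d: "fps_nth ?d i \<in> polys_in ({..<l} \<times> UNIV)" for i
    using deriv_span_deriv by (intro fps_deriv_in_polys x_ser_nth_in) auto
  have bg: "xdeg l n (fls_nth (b * g) j)" for j
    using assms(2) deriv_span_deriv by (intro fls_mult_base_xdeg) (auto simp: xi_ok_def)
  have "xdeg l n (fls_nth (fps_to_fls ?d * (b * g)) j)" for j
    by (rule fls_mult_base_xdeg[OF fps_to_fls_nth_in[OF d] bg])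
  moreover have "mJ l n (xi_pair l (fps_to_fls p * (b * fps_to_fls ?d * g)))"
    if p: "\<And>i. fps_nth p i \<in> polys_in ({..<l} \<times> UNIV)" for p
  proof -
    have pbg: "xdeg l n (fls_nth (fps_to_fls p * (b * g)) j)" for j
      by (rule fls_mult_base_xdeg[OF fps_to_fls_nth_in[OF p] bg])
    have "mJ l 0 (fls_nth (fps_to_fls (x_ser l * ?d)) i)" for i
      using deriv_span_deriv by (auto intro: x_ser_mult_deriv_mJ mJ_zero)
    then have prod: "mJ l n (fls_nth (fps_to_fls (x_ser l * ?d)) i * fls_nth (fps_to_fls p * (b * g)) j)" for i j
      using mJ_mult[of l 0 _ n] pbg by fastforce
    have "mJ l n (fls_nth (fps_to_fls (x_ser l * ?d) * (fps_to_fls p * (b * g))) (- 1))"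
      by (rule fls_mult_nth_in[of "Collect (mJ l n)", unfolded mem_Collect_eq])
        (rule mJ_zero, rule mJ_add, assumption+, rule prod)
    then show ?thesis
      by (simp add: xi_pair_def fls_times_fps_to_fls mult_ac)
  qed
  ultimately show ?case by (auto simp: xi_ok_def mult_ac)
next
  case (deriv_span_add e g h)
  then show ?case by (auto simp: distrib_right intro: xi_ok_add)
qed

text \<open>On x_l the twist with \<sigma> = -1 is multiplication by v - z, so only the terms i = 0
  and i = 1 survive, and for k = 0 only the first.\<close>

lemma untwist_xi:
  "untwist l (var (l, k)) = fls_const (var (l, k)) * fls_X - (if k = 0 then 0 else fls_const (var (l, k - 1)))"
proof -
  have "untwist l (var (l, k)) =
      (\<Sum>i\<le>k. fls_const (const ((-1) ^ i * (1 gchoose i)) * var (l, k - i)) * fls_X_intpow (1 - int i))"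
    by (simp add: untwist_def theta_var_eq theta_var_def ring_map_sum[OF ring_map_to_fls] to_fls_single)
  also have "\<dots> = (\<Sum>i\<in>{..k} \<inter> {..1}. fls_const (const ((-1) ^ i * (1 gchoose i)) * var (l, k - i)) *
      fls_X_intpow (1 - int i))"
  proof (rule sum.mono_neutral_right)
    show "\<forall>i\<in>{..k} - {..k} \<inter> {..1}. fls_const (const ((-1) ^ i * (1 gchoose i)) * var (l, k - i)) *
      fls_X_intpow (1 - int i) = 0"
    proof
      fix i assume "i \<in> {..k} - {..k} \<inter> {..1}"
      then have "i > 1" by auto
      then have "(1 :: complex) gchoose i = 0"
        by (metis binomial_eq_0 binomial_gbinomial of_nat_0 of_nat_1)
      then show "fls_const (const ((-1) ^ i * (1 gchoose i)) * var (l, k - i)) * fls_X_intpow (1 - int i) = 0"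
        by simp
    qed
  qed auto
  also have "{..k} \<inter> {..1} = (if k = 0 then {0} else {0, 1 :: nat})" by auto
  finally show ?thesis
    by (auto simp: fls_X_conv_shift_1 single_uminus const_def simp flip: fls_const_uminus)
qed

lemma xi_ok_fps:
  assumes "\<And>i. fps_nth p i \<in> polys_in ({..<l} \<times> UNIV)"
  shows "xi_ok l n (fps_to_fls p)"
proof -
  have "xi_pair l (fps_to_fls q * fps_to_fls p) = 0" for q
    by (rule xi_pair_nonneg) (simp flip: fls_times_fps_to_fls)
  then show ?thesis
    using assms by (auto simp: xi_ok_def intro: xdeg_base xdeg_zero mJ_zero)
qed

text \<open>The new factor has no pole: its power of v goes into the test series, and its
  coefficients raise the degree by one.\<close>

lemma xi_ok_untwist_xi_mult:
  assumes "xi_ok l n g" shows "xi_ok l (Suc n) (untwist l (var (l, k)) * g)"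
proof -
  have "xdeg l (1 + n) (fls_nth (untwist l (var (l, k)) * g) j)" for j
  proof -
    have "xdeg l 1 (fls_nth (untwist l (var (l, k))) i)" for i
      using theta_xdeg[OF xdeg_single_var[of l l k], of "-1" i] by (simp add: untwist_def)
    moreover have "xdeg l n (fls_nth g i)" for i using assms by (auto simp: xi_ok_def)
    ultimately have "xdeg l (1 + n) (fls_nth (untwist l (var (l, k))) i * fls_nth g i')" for i i'
      by (rule xdeg_mult)
    then show ?thesis
      using fls_mult_nth_in[of "{p. xdeg l (1 + n) p}" j "untwist l (var (l, k))" g]
      by (auto intro: xdeg_zero xdeg_add)
  qed
  moreover have "mJ l (n + 1) (xi_pair l (fps_to_fls p * (untwist l (var (l, k)) * g)))"
    if p: "\<And>i. fps_nth p i \<in> polys_in ({..<l} \<times> UNIV)" for p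
  proof -
    have v: "xdeg l 1 (var (l, i))" for i using xdeg_single_var[of l l i] by simp
    define g1 where "g1 = xi_pair l (fps_to_fls (p * fps_X) * g)"
    define g2 where "g2 = xi_pair l (fps_to_fls p * g)"
    have g1: "mJ l n g1"
      unfolding g1_def by (rule xi_ok_pair[OF assms]) (use p in \<open>auto intro: zero_in_polys\<close>)
    have g2: "mJ l n g2"
      unfolding g2_def by (rule xi_ok_pair[OF assms p])
    have "fps_to_fls p * (untwist l (var (l, k)) * g) =
        fls_const (var (l, k)) * (fps_to_fls (p * fps_X) * g) -
        (if k = 0 then 0 else fls_const (var (l, k - 1)) * (fps_to_fls p * g))"
      by (auto simp: untwist_xi fls_times_fps_to_fls algebra_simps)
    then have "xi_pair l (fps_to_fls p * (untwist l (var (l, k)) * g)) =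
        var (l, k) * g1 - (if k = 0 then 0 else var (l, k - 1) * g2)"
      by (simp add: xi_pair_diff xi_pair_const_mult xi_pair_zero g1_def g2_def)
    then show ?thesis
      using mJ_mult[OF g1 v] mJ_mult[OF g2 v] by (auto simp: mult.commute[of "var _"] intro: mJ_diff)
  qed
  ultimately show ?thesis by (auto simp: xi_ok_def)
qed

lemma xi_ok_untwist: "xdeg l n q \<Longrightarrow> xi_ok l n (untwist l q)"
proof (induction rule: xdeg.induct)
  case (xdeg_base p n)
  then show ?case
  proof (induction rule: polys_in_induct)
    case (const c)
    have "xi_ok l n (fps_to_fls (fps_const (const c)))"
      by (rule xi_ok_fps) (auto intro: zero_in_polys const_in_polys)
    then show ?case by (simp add: untwist_const)
  next
    case (add p q)
    then show ?case by (simp add: ring_map_add[OF ring_map_untwist] xi_ok_add)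
  next
    case (var v p)
    then obtain u N where v: "v = (u, N)" "u < l" by auto
    have "untwist l (var v) = pole (l - 1 - u) u N"
      unfolding untwist_def theta_var_eq v(1) using v(2)
      by (intro to_fls_theta_var_pole) (simp add: of_nat_diff)
    then show ?case
      using xi_ok_deriv_span_mult[OF pole_deriv_span[OF v(2)] var.IH] v(2)
      by (simp add: ring_map_mult[OF ring_map_untwist])
  qed
next
  case (xdeg_add n p q)
  then show ?case by (simp add: ring_map_add[OF ring_map_untwist] xi_ok_add)
next
  case (xdeg_var n p k)
  then show ?case by (simp add: ring_map_mult[OF ring_map_untwist] xi_ok_untwist_xi_mult)
qed

text \<open>Pairing with \<xi> brings in one more x_l^(k), but the poles of an untwisted polynomial
  come from its lower variables alone, and there the relations remove the extra factor.\<close>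

lemma mJ_xi_pair_untwist:
  assumes "xdeg l n q" "a \<ge> 0"
  shows "mJ l n (xi_pair l (fls_X_intpow a * untwist l q))"
proof -
  have eq: "fls_X_intpow a = (fps_to_fls (fps_X ^ nat a) :: (nat \<times> nat) cpoly fls)"
    using assms(2) by (intro fls_eqI) (auto simp: fps_X_power_nth)
  show ?thesis
    unfolding eq
    by (rule xi_ok_pair[OF xi_ok_untwist[OF assms(1)]])
      (auto simp: fps_X_power_nth intro: zero_in_polys one_in_polys)
qed

subsection \<open>The kernel lies in the ideal of quadratic relations\<close>

text \<open>The residue of \<xi>(v) times the coefficientwise untwisted polar part of the quotient;
  a large M loses no polar term.\<close>

definition xi_sum :: "nat \<Rightarrow> nat \<Rightarrow> (nat \<times> nat) cpoly \<Rightarrow> (nat \<times> nat) cpoly" where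
  "xi_sum l M f = (\<Sum>K<M. xi_pair l (fls_X_intpow (- 1 - int K) * untwist l (xi_res l K f)))"

lemma untwist_add: "untwist l (f + g) = untwist l f + untwist l g"
  and untwist_mult: "untwist l (f * g) = untwist l f * untwist l g"
  and untwist_zero: "untwist l 0 = 0"
  and untwist_sum: "untwist l (sum h S) = (\<Sum>i\<in>S. untwist l (h i))"
  using ring_map_untwist by (simp_all add: ring_map_add ring_map_mult ring_map_zero ring_map_sum)

lemma untwist_diff: "untwist l (f - g) = untwist l f - untwist l g"
  using untwist_add[of l "f - g" g] by (simp add: algebra_simps)

lemma xi_sum_add: "xi_sum l M (f + g) = xi_sum l M f + xi_sum l M g"
  by (simp add: xi_sum_def xi_res_add untwist_add distrib_left xi_pair_add sum.distrib)

lemma xi_sum_base: "f \<in> polys_in ({..<l} \<times> UNIV) \<Longrightarrow> xi_sum l M f = 0"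
  by (simp add: xi_sum_def xi_res_base untwist_zero xi_pair_zero)

text \<open>By \<open>untwist_theta\<close> the sum over all exponents m gives the constant f, and
  v^(-1-k) f pairs to x_l^(k) f. The left side lacks the terms with m > k, which carry nonnegative
  powers of v besides the untwisted coefficient.\<close>

lemma sum_pole_part:
  assumes M: "\<And>m. m \<in> Poly_Mapping.keys (theta 1 l f) \<Longrightarrow> int k - int M < m"
  shows "(\<Sum>K<M. xi_pair l (fls_X_intpow (- 1 - int K) *
             untwist l (Poly_Mapping.lookup (theta 1 l f) (int k - int K)))) =
         var (l, k) * f - (\<Sum>m\<in>Poly_Mapping.keys (theta 1 l f) \<inter> {int k<..}.
             xi_pair l (fls_X_intpow (m - 1 - int k) * untwist l (Poly_Mapping.lookup (theta 1 l f) m)))"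
proof -
  let ?L = "Poly_Mapping.lookup (theta 1 l f)" and ?K = "Poly_Mapping.keys (theta 1 l f)"
  let ?g = "\<lambda>m. xi_pair l (fls_X_intpow (m - 1 - int k) * untwist l (?L m))"
  have ext: "(\<Sum>m\<in>?K. untwist l (?L m) * fls_X_intpow m) = fls_const f"
    using untwist_theta[of l f] unfolding pm_lift_def .
  have "var (l, k) * f = xi_pair l (fls_X_intpow (- 1 - int k) *
      (\<Sum>m\<in>?K. untwist l (?L m) * fls_X_intpow m))"
    unfolding ext by (rule xi_pair_intpow[symmetric])
  also have "\<dots> = sum ?g ?K"
    unfolding sum_distrib_left xi_pair_sum
  proof (rule sum.cong)
    fix m
    have "fls_X_intpow (- 1 - int k) * (untwist l (?L m) * fls_X_intpow m) =
        (fls_X_intpow (- 1 - int k) * fls_X_intpow m) * untwist l (?L m)"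
      by (simp only: mult_ac)
    also have "fls_X_intpow (- 1 - int k) * fls_X_intpow m = (fls_X_intpow (m - 1 - int k) :: (nat \<times> nat) cpoly fls)"
      unfolding fls_X_intpow_times_fls_X_intpow by (simp add: algebra_simps)
    finally show "xi_pair l (fls_X_intpow (- 1 - int k) * (untwist l (?L m) * fls_X_intpow m)) = ?g m"
      by (simp only:)
  qed simp
  also have "\<dots> = sum ?g (?K \<inter> {..int k}) + sum ?g (?K \<inter> {int k<..})"
    by (subst sum.union_disjoint[symmetric]) (auto intro!: sum.cong)
  also have "sum ?g (?K \<inter> {..int k}) = sum ?g {int k - int M<..int k}"
    using M by (intro sum.mono_neutral_left) (auto simp: in_keys_iff untwist_zero xi_pair_zero)
  also have "\<dots> = (\<Sum>K<M. ?g (int k - int K))"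
    by (rule sum.reindex_bij_witness[of _ "\<lambda>K. int k - int K" "\<lambda>m. nat (int k - m)"]) auto
  finally show ?thesis by (simp add: algebra_simps)
qed

text \<open>When terms are collected by the value of K + i, the untwisted variables v x_l^(k+1+i) -
  x_l^(k+i) telescope. One end yields the sum on the right, the other x_l^(k) times
  \<open>xi_sum\<close>.\<close>

lemma sum_tail_part:
  assumes M: "\<And>K. K \<ge> M \<Longrightarrow> xi_res l K f = 0"
  shows "(\<Sum>K<M. xi_pair l (fls_X_intpow (- 1 - int K) *
            untwist l (\<Sum>i\<le>M. var (l, k + 1 + i) * xi_res l (K + i) f))) =
         (\<Sum>K<M. var (l, k + 1 + K) * xi_pair l (untwist l (xi_res l K f))) - var (l, k) * xi_sum l M f"
proof -
  let ?X = "fls_X_intpow :: int \<Rightarrow> (nat \<times> nat) cpoly fls"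
  define V where "V K = untwist l (xi_res l K f)" for K
  define h where "h K i = ?X (- 1 - int K) * (untwist l (var (l, k + 1 + i)) * V (K + i))" for K i
  have V: "V K = 0" if "K \<ge> M" for K using M[OF that] by (simp add: V_def untwist_zero)
  have "(\<Sum>K<M. ?X (- 1 - int K) * untwist l (\<Sum>i\<le>M. var (l, k + 1 + i) * xi_res l (K + i) f)) =
      (\<Sum>K<M. \<Sum>i\<le>M. h K i)"
    by (simp only: untwist_sum untwist_mult sum_distrib_left h_def V_def)
  also have "\<dots> = (\<Sum>(K, i)\<in>{..<M} \<times> {..M}. h K i)"
    by (simp add: sum.cartesian_product)
  \<comment> \<open>Outside this triangle the residue of index K + i is zero.\<close>
  also have "\<dots> = (\<Sum>(K, i)\<in>{(K, i). K + i < M}. h K i)"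
    by (rule sum.mono_neutral_right) (auto simp: h_def, metis V mult_zero_right not_less)
  also have "\<dots> = (\<Sum>K<M. \<Sum>i\<le>K. h i (K - i))"
    by (rule sum.triangle_reindex)
  also have "\<dots> = (\<Sum>K<M. fls_const (var (l, k + 1 + K)) * V K -
      fls_const (var (l, k)) * (?X (- 1 - int K) * V K))"
  proof (rule sum.cong)
    fix K
    define t where "t i = ?X (- int i) * fls_const (var (l, k + 1 + K - i))" for i
    have "h i (K - i) = (t i - t (Suc i)) * V K" if "i \<le> K" for i
    proof -
      have "?X (- 1 - int i) * (fls_const (var (l, k + 1 + (K - i))) * fls_X) = t i"
      proof -
        have "?X (- 1 - int i) * (fls_const (var (l, k + 1 + (K - i))) * fls_X) =
            (?X (- 1 - int i) * ?X 1) * fls_const (var (l, k + 1 + (K - i)))"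
          by (simp add: fls_X_conv_shift_1 mult_ac)
        also have "?X (- 1 - int i) * ?X 1 = ?X (- int i)"
          unfolding fls_X_intpow_times_fls_X_intpow by simp
        finally have "?X (- 1 - int i) * (fls_const (var (l, k + 1 + (K - i))) * fls_X) =
            ?X (- int i) * fls_const (var (l, k + 1 + (K - i)))" .
        moreover have "k + 1 + (K - i) = k + 1 + K - i" using that by simp
        ultimately show ?thesis by (simp only: t_def)
      qed
      moreover have "?X (- 1 - int i) * fls_const (var (l, k + 1 + (K - i) - 1)) = t (Suc i)"
        using that by (simp add: t_def)
      ultimately have "?X (- 1 - int i) * untwist l (var (l, k + 1 + (K - i))) = t i - t (Suc i)"
        unfolding untwist_xi by (simp add: right_diff_distrib)
      moreover have "h i (K - i) = (?X (- 1 - int i) * untwist l (var (l, k + 1 + (K - i)))) * V K"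
        using that by (simp add: h_def mult.assoc)
      ultimately show ?thesis by simp
    qed
    then have "(\<Sum>i\<le>K. h i (K - i)) = (\<Sum>i\<le>K. t i - t (Suc i)) * V K"
      by (simp add: sum_distrib_right)
    also have "\<dots> = (t 0 - t (Suc K)) * V K"
      by (simp add: sum_telescope)
    finally show "(\<Sum>i\<le>K. h i (K - i)) = fls_const (var (l, k + 1 + K)) * V K -
        fls_const (var (l, k)) * (?X (- 1 - int K) * V K)"
      by (simp add: t_def algebra_simps)
  qed simp
  finally have eq: "(\<Sum>K<M. ?X (- 1 - int K) * untwist l (\<Sum>i\<le>M. var (l, k + 1 + i) * xi_res l (K + i) f)) =
     (\<Sum>K<M. fls_const (var (l, k + 1 + K)) * V K - fls_const (var (l, k)) * (?X (- 1 - int K) * V K))" .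
  show ?thesis
    unfolding xi_pair_sum[symmetric] eq
    unfolding xi_pair_sum xi_pair_diff xi_pair_const_mult xi_sum_def V_def
    by (simp only: sum_subtractf sum_distrib_left)
qed

(* An Euler identity: each of the n factors x_l^{(k)} contributes one copy of f to the residue. *)
lemma xi_sum_euler:
  assumes "xdeg l n f"
  shows "\<exists>M0. \<forall>M\<ge>M0. mJ l (n - 1) (xi_sum l M f - of_nat n * f)"
  using assms
proof (induction rule: xdeg.induct)
  case (xdeg_base p n)
  have "xdeg l (n - 1) (- (of_nat n * p))"
    using xdeg_base by (intro xdeg.xdeg_base uminus_in_polys mult_in_polys of_nat_in_polys)
  then show ?case by (auto simp: xi_sum_base[OF xdeg_base] intro: mJ_xdeg)
next
  case (xdeg_add n p q)
  then obtain M1 M2 where "\<forall>M\<ge>M1. mJ l (n - 1) (xi_sum l M p - of_nat n * p)"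
    "\<forall>M\<ge>M2. mJ l (n - 1) (xi_sum l M q - of_nat n * q)" by blast
  then have "\<forall>M\<ge>max M1 M2. mJ l (n - 1) ((xi_sum l M p - of_nat n * p) + (xi_sum l M q - of_nat n * q))"
    by (auto intro: mJ_add)
  then show ?case
    unfolding xi_sum_add by (intro exI[of _ "max M1 M2"]) (simp add: algebra_simps)
next
  case (xdeg_var n f k)
  from xdeg_var.IH obtain M1 where M1: "\<And>M. M \<ge> M1 \<Longrightarrow> mJ l (n - 1) (xi_sum l M f - of_nat n * f)"
    by blast
  obtain M2 where M2: "\<And>K. K \<ge> M2 \<Longrightarrow> xi_res l K f = 0" using xi_res_bound by blast
  let ?L = "Poly_Mapping.lookup (theta 1 l f)" and ?K = "Poly_Mapping.keys (theta 1 l f)"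
  \<comment> \<open>The twist of f has finitely many exponents, so they are bounded below.\<close>
  obtain M3 where M3: "\<And>m. m \<in> ?K \<Longrightarrow> int k - int M3 < m"
  proof
    fix m assume "m \<in> ?K"
    then have "- m \<le> Max (uminus ` ?K)" by auto
    then show "int k - int (k + 1 + nat (Max (uminus ` ?K))) < m" by linarith
  qed
  have "mJ l n (xi_sum l M (var (l, k) * f) - of_nat (Suc n) * (var (l, k) * f))"
    if M: "M \<ge> max M1 (max M2 M3)" for M
  proof -
    define P where "P = (\<Sum>m\<in>?K \<inter> {int k<..}. xi_pair l (fls_X_intpow (m - 1 - int k) * untwist l (?L m)))"
    define T where "T = (\<Sum>K<M. var (l, k + 1 + K) * xi_pair l (untwist l (xi_res l K f)))"
    have res: "xi_res l K (var (l, k) * f) = ?L (int k - int K) -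
        (\<Sum>i\<le>M. var (l, k + 1 + i) * xi_res l (K + i) f)" for K
      using M2 M by (intro xi_res_var_mult) auto
    have A: "(\<Sum>K<M. xi_pair l (fls_X_intpow (- 1 - int K) * untwist l (?L (int k - int K)))) =
        var (l, k) * f - P"
      unfolding P_def using M3 M by (intro sum_pole_part) force
    have C: "(\<Sum>K<M. xi_pair l (fls_X_intpow (- 1 - int K) *
            untwist l (\<Sum>i\<le>M. var (l, k + 1 + i) * xi_res l (K + i) f))) =
         T - var (l, k) * xi_sum l M f"
      unfolding T_def using M2 M by (intro sum_tail_part) auto
    have "xi_sum l M (var (l, k) * f) = (var (l, k) * f - P) - (T - var (l, k) * xi_sum l M f)"
      unfolding A[symmetric] C[symmetric]
      by (simp only: xi_sum_def res untwist_diff right_diff_distrib xi_pair_diff sum_subtractf)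
    \<comment> \<open>One copy comes from the pole part and n copies from the induction hypothesis;
      P and T have degree at most n modulo the relations.\<close>
    then have "xi_sum l M (var (l, k) * f) - of_nat (Suc n) * (var (l, k) * f) =
        var (l, k) * (xi_sum l M f - of_nat n * f) - P - T"
      by (simp add: algebra_simps)
    moreover have "mJ l n P"
      unfolding P_def by (intro mJ_sum mJ_xi_pair_untwist theta_xdeg xdeg_var.hyps) auto
    moreover have "mJ l n (var (l, k + 1 + K) * xi_pair l (untwist l (xi_res l K f)))" for K
    proof (rule mJ_var)
      show "mJ l (n - 1) (xi_pair l (untwist l (xi_res l K f)))"
        using mJ_xi_pair_untwist[OF xi_res_xdeg[OF xdeg_var.hyps], of 0 K] by simp
      show "xi_pair l (untwist l (xi_res l K f)) = 0" if "n = 0"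
        using xdeg_0D[OF xdeg_var.hyps that] by (simp add: xi_res_base untwist_zero xi_pair_zero)
    qed
    then have "mJ l n T" unfolding T_def by (intro mJ_sum)
    moreover have "mJ l n (var (l, k) * (xi_sum l M f - of_nat n * f))"
    proof (rule mJ_var)
      show "mJ l (n - 1) (xi_sum l M f - of_nat n * f)" using M M1 by simp
      show "xi_sum l M f - of_nat n * f = 0" if "n = 0"
        using xdeg_0D[OF xdeg_var.hyps that] that by (simp add: xi_sum_base)
    qed
    ultimately show ?thesis by (auto intro: mJ_diff)
  qed
  then show ?case
    unfolding diff_Suc_1 by (intro exI[of _ "max M1 (max M2 M3)"] allI impI)
qed

lemma gen_ideal_of_nat_mult:
  assumes "of_nat (Suc n) * f \<in> gen_ideal G" shows "(f :: 'v cpoly) \<in> gen_ideal G"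
proof -
  have "const (1 / of_nat (Suc n)) * (of_nat (Suc n) * f) = const (1 / of_nat (Suc n) * of_int (int (Suc n))) * f"
    unfolding const_mult const_of_int by (simp add: mult.assoc del: of_nat_Suc)
  also have "\<dots> = f" by (simp del: of_nat_Suc)
  finally show ?thesis using gen_ideal_mult[OF assms, of "const (1 / of_nat (Suc n))"] by simp
qed

text \<open>Induction on the degree in the x_l^(k). The residues of f and their untwisted
  coefficients are kernel elements of smaller degree, so \<open>xi_sum\<close> lies in the ideal. By
  the Euler identity it is n f plus an element of the ideal plus a remainder of smaller
  degree.\<close>

lemma kernel_step:
  assumes L: "L \<ge> 1" "l \<le> L"
    and Q: "\<And>g. g \<in> Q_gens l \<Longrightarrow> nu L g = 0"
    and IH: "\<And>f. f \<in> polys_in ({..<l} \<times> UNIV) \<Longrightarrow> nu L f = 0 \<Longrightarrow> f \<in> gen_ideal (Q_gens l)"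
    and f: "xdeg l n f" "nu L f = 0"
  shows "f \<in> gen_ideal (Q_gens l)"
  using f
proof (induction n arbitrary: f)
  case 0
  then show ?case using xdeg_0D IH by blast
next
  case (Suc n)
  have inL: "h \<in> polys_in ({0..L} \<times> UNIV)" if "xdeg l m h" for h m
    by (rule polys_in_mono[OF _ xdeg_in[OF that]]) (use L(2) in auto)
  obtain M where "mJ l n (xi_sum l M f - of_nat (Suc n) * f)"
    using xi_sum_euler[OF Suc.prems(1)] by auto
  then obtain j where j: "j \<in> gen_ideal (Q_gens l)" "xdeg l n (xi_sum l M f - of_nat (Suc n) * f - j)"
    unfolding mJ_def by blast
  have sum: "xi_sum l M f \<in> gen_ideal (Q_gens l)"
    unfolding xi_sum_def
  proof (rule gen_ideal_sum)
    fix K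
    have r: "xdeg l n (xi_res l K f)" using xi_res_xdeg[OF Suc.prems(1), of K] by simp
    have "nu L (xi_res l K f) = 0"
      using nu_xi_res_eq_0[OF L xdeg_in[OF Suc.prems(1)] Suc.prems(2)] .
    then have "nu L (Poly_Mapping.lookup (theta (- 1) l (xi_res l K f)) i) = 0" for i
      by (rule nu_theta_eq_0[OF L(1) inL[OF r]])
    then have u: "fls_nth (untwist l (xi_res l K f)) i \<in> gen_ideal (Q_gens l)" for i
      unfolding untwist_def to_fls_nth by (intro Suc.IH theta_xdeg r)
    have "fls_nth (fps_to_fls (x_ser l) * (fls_X_intpow (- 1 - int K) * untwist l (xi_res l K f))) (- 1)
        \<in> gen_ideal (Q_gens l)"
    proof (rule fls_mult_nth_in)
      fix i j'
      show "fls_nth (fps_to_fls (x_ser l)) i * fls_nth (fls_X_intpow (- 1 - int K) * untwist l (xi_res l K f)) j'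
        \<in> gen_ideal (Q_gens l)"
        unfolding fls_shift_one_mult fls_shift_nth by (intro gen_ideal_mult u)
    qed (auto intro: gen_ideal_zero gen_ideal_add)
    then show "xi_pair l (fls_X_intpow (- 1 - int K) * untwist l (xi_res l K f)) \<in> gen_ideal (Q_gens l)"
      unfolding xi_pair_def .
  qed
  \<comment> \<open>The relations vanish under \<open>nu L\<close>, so the remainder is in the
    kernel too and the induction hypothesis applies to it.\<close>
  let ?h = "xi_sum l M f - of_nat (Suc n) * f - j"
  have van: "nu L p = 0" if "p \<in> gen_ideal (Q_gens l)" for p
    using ring_map_vanishes_gen_ideal[OF ring_map_nu Q that] .
  have "xi_sum l M f = ?h + j + of_nat (Suc n) * f" by simp
  then have "nu L (xi_sum l M f) = nu L ?h + nu L j + nu L (of_nat (Suc n)) * nu L f"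
    by (metis ring_map_add[OF ring_map_nu] ring_map_mult[OF ring_map_nu])
  then have "nu L ?h = 0"
    using van[OF sum] van[OF j(1)] Suc.prems(2) by simp
  then have "?h \<in> gen_ideal (Q_gens l)" by (rule Suc.IH[OF j(2)])
  then have "xi_sum l M f + - (?h + j) \<in> gen_ideal (Q_gens l)"
    by (intro gen_ideal_add gen_ideal_uminus sum j(1))
  then show ?case by (intro gen_ideal_of_nat_mult[of n f]) simp
qed

text \<open>L stays fixed while l varies, so that the statement for fewer variables concerns a
  restriction of the same homomorphism.\<close>

lemma kernel_subset_gen_ideal:
  assumes L: "L \<ge> 1"
    and Q: "\<And>l g. l \<le> L \<Longrightarrow> g \<in> Q_gens l \<Longrightarrow> nu L g = 0"
    and f: "l \<le> L" "f \<in> polys_in ({..<Suc l} \<times> UNIV)" "nu L f = 0"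
  shows "f \<in> gen_ideal (Q_gens l)"
  using f
proof (induction l arbitrary: f)
  case 0
  obtain n where n: "xdeg 0 n f" using xdeg_ex 0 by blast
  have "g \<in> gen_ideal (Q_gens 0)" if "g \<in> polys_in ({..<0::nat} \<times> UNIV)" "nu L g = 0" for g
  proof -
    \<comment> \<open>Without variables only constants remain, and on these \<open>nu\<close> is
      injective.\<close>
    have "\<exists>c. g = const c" using that(1)
      by (induction rule: polys_in_induct) (auto simp flip: const_add)
    then obtain c where g: "g = const c" ..
    have "c = 0"
    proof (rule ccontr)
      assume "c \<noteq> 0"
      then have "const (inverse c) * nu L g = 1"
        by (simp add: g nu_const flip: const_mult)
      then show False using that(2) by simp
    qed
    then show ?thesis by (simp add: g gen_ideal_zero)
  qed
  then show ?case by (intro kernel_step[OF L 0(1) Q[OF 0(1)] _ n 0(3)]) auto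
next
  case (Suc l)
  obtain n where n: "xdeg (Suc l) n f" using xdeg_ex Suc.prems by blast
  have "Q_gens l \<subseteq> Q_gens (Suc l)" unfolding Q_gens_def by fastforce
  then have "g \<in> gen_ideal (Q_gens (Suc l))" if "g \<in> polys_in ({..<Suc l} \<times> UNIV)" "nu L g = 0" for g
    using Suc.IH[of g] that Suc.prems(1) by (auto intro: gen_ideal_mono)
  then show ?case by (intro kernel_step[OF L Suc.prems(1) Q[OF Suc.prems(1)] _ n Suc.prems(3)])
qed

subsection \<open>Alternating sums of derivatives\<close>

definition is_ideal :: "'a::comm_ring_1 set \<Rightarrow> bool" where
  "is_ideal I \<longleftrightarrow> 0 \<in> I \<and> (\<forall>x\<in>I. \<forall>y\<in>I. x + y \<in> I) \<and> (\<forall>x\<in>I. \<forall>h. h * x \<in> I)"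

lemma is_ideal_zero: "is_ideal I \<Longrightarrow> 0 \<in> I"
  and is_ideal_add: "is_ideal I \<Longrightarrow> x \<in> I \<Longrightarrow> y \<in> I \<Longrightarrow> x + y \<in> I"
  and is_ideal_mult: "is_ideal I \<Longrightarrow> x \<in> I \<Longrightarrow> h * x \<in> I"
  by (auto simp: is_ideal_def)

lemma is_ideal_mult_right: "is_ideal I \<Longrightarrow> x \<in> I \<Longrightarrow> x * h \<in> I"
  using is_ideal_mult[of I x h] by (simp add: mult.commute)

lemma is_ideal_uminus: "is_ideal I \<Longrightarrow> x \<in> I \<Longrightarrow> - x \<in> I"
  using is_ideal_mult[of I x "- 1"] by simp

lemma is_ideal_diff: "is_ideal I \<Longrightarrow> x \<in> I \<Longrightarrow> y \<in> I \<Longrightarrow> x - y \<in> I"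
  using is_ideal_add[of I x "- y"] is_ideal_uminus[of I y] by simp

lemma is_ideal_sum: "is_ideal I \<Longrightarrow> (\<And>i. i \<in> S \<Longrightarrow> f i \<in> I) \<Longrightarrow> sum f S \<in> I"
  by (induction S rule: infinite_finite_induct) (auto simp: is_ideal_zero is_ideal_add)

lemma is_ideal_diff_mult:
  "is_ideal I \<Longrightarrow> p - p' \<in> I \<Longrightarrow> q - q' \<in> I \<Longrightarrow> p * q - p' * q' \<in> I"
proof -
  assume I: "is_ideal I" "p - p' \<in> I" "q - q' \<in> I"
  have "p * (q - q') + q' * (p - p') \<in> I"
    using I by (intro is_ideal_add is_ideal_mult)
  then show ?thesis by (simp add: algebra_simps)
qed

(* Leibniz' rule, when all terms with fewer derivatives on the h i vanish modulo I. *)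
lemma sum_derivs_const_mult:
  fixes e h :: "'i \<Rightarrow> 'a::comm_ring_1 fps"
  assumes I: "is_ideal I"
    and van: "\<And>v. v < w \<Longrightarrow> (\<Sum>i\<in>S. e i * (fps_deriv ^^ v) (h i)) \<in> I"
  shows "(\<Sum>i\<in>S. e i * (fps_deriv ^^ w) (c * h i)) - c * (\<Sum>i\<in>S. e i * (fps_deriv ^^ w) (h i)) \<in> I"
  using van
proof (induction w arbitrary: c h)
  case 0
  then show ?case by (simp add: sum_distrib_left mult.left_commute is_ideal_zero[OF I])
next
  case (Suc w)
  let ?Z = "\<lambda>w h. \<Sum>i\<in>S. e i * (fps_deriv ^^ w) (h i)"
  have add: "(fps_deriv ^^ w) (f + g) = (fps_deriv ^^ w) f + (fps_deriv ^^ w) g" for f g :: "'a fps"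
    by (induction w) simp_all
  have "?Z (Suc w) (\<lambda>i. c * h i) = ?Z w (\<lambda>i. fps_deriv c * h i) + ?Z w (\<lambda>i. c * fps_deriv (h i))"
    unfolding funpow_Suc_right o_apply fps_deriv_mult add distrib_left sum.distrib by simp
  moreover have "?Z w (\<lambda>i. fps_deriv c * h i) - fps_deriv c * ?Z w h \<in> I"
    using Suc.prems by (intro Suc.IH) auto
  moreover have "fps_deriv c * ?Z w h \<in> I"
    using Suc.prems by (intro is_ideal_mult[OF I]) auto
  moreover have "?Z w (\<lambda>i. c * fps_deriv (h i)) - c * ?Z w (\<lambda>i. fps_deriv (h i)) \<in> I"
  proof (rule Suc.IH)
    fix v assume "v < w"
    then show "(\<Sum>i\<in>S. e i * (fps_deriv ^^ v) (fps_deriv (h i))) \<in> I"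
      using Suc.prems[of "Suc v"] unfolding funpow_Suc_right o_apply by simp
  qed
  moreover have "?Z (Suc w) h = ?Z w (\<lambda>i. fps_deriv (h i))"
    unfolding funpow_Suc_right o_apply ..
  ultimately have "?Z (Suc w) (\<lambda>i. c * h i) - c * ?Z (Suc w) h =
      (?Z w (\<lambda>i. fps_deriv c * h i) - fps_deriv c * ?Z w h) + fps_deriv c * ?Z w h +
      (?Z w (\<lambda>i. c * fps_deriv (h i)) - c * ?Z w (\<lambda>i. fps_deriv (h i)))"
    by (simp only:) (simp add: algebra_simps)
  also have "\<dots> \<in> I"
    by (intro is_ideal_add[OF I]) fact+
  finally show ?case .
qed

text \<open>Pascal's rule and an index shift turn an alternating sum of order n + 1 into one of
  order n over differences.\<close>

lemma alternating_binomial_sum_Suc: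
  fixes t :: "nat \<Rightarrow> 'a::comm_ring_1"
  shows "(\<Sum>i\<le>Suc n. (-1) ^ i * of_nat (Suc n choose i) * t i) =
    (\<Sum>i\<le>n. (-1) ^ i * of_nat (n choose i) * (t i - t (Suc i)))"
proof -
  have "(\<Sum>i\<le>Suc n. (-1) ^ i * of_nat (Suc n choose i) * t i) =
      t 0 + (\<Sum>i\<le>n. (-1) ^ Suc i * of_nat (n choose Suc i) * t (Suc i)) +
        (\<Sum>i\<le>n. (-1) ^ Suc i * of_nat (n choose i) * t (Suc i))"
    unfolding sum.atMost_Suc_shift by (simp add: algebra_simps sum.distrib sum_negf sum_subtractf)
  also have "t 0 + (\<Sum>i\<le>n. (-1) ^ Suc i * of_nat (n choose Suc i) * t (Suc i)) =
      (\<Sum>i\<le>Suc n. (-1) ^ i * of_nat (n choose i) * t i)"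
    unfolding sum.atMost_Suc_shift by simp
  also have "\<dots> = (\<Sum>i\<le>n. (-1) ^ i * of_nat (n choose i) * t i)"
    by (simp add: binomial_eq_0)
  finally show ?thesis by (simp add: algebra_simps sum_subtractf sum_negf)
qed

(* Each difference of w-th derivatives gains a factor vanishing on the diagonal, so N of them
   kill the w-th derivatives for w < N. *)
lemma alternating_derivs_eq_0:
  fixes a b f :: "'a::comm_ring_1 fps"
  assumes "w < N"
  shows "(\<Sum>i\<le>N. (-1) ^ i * of_nat (N choose i) *
    ((fps_deriv ^^ w) (f * a ^ (N - i) * b ^ i) * (a ^ i * b ^ (N - i)))) = 0"
  using assms
proof (induction N arbitrary: w f)
  case (Suc N)
  define e where "e i = (-1) ^ i * of_nat (N choose i) * (a ^ i * b ^ (N - i))" for i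
  define Z where "Z v g = (\<Sum>i\<le>N. e i * (fps_deriv ^^ v) (g * a ^ (N - i) * b ^ i))" for v g
  have Z0: "Z v g = 0" if "v < N" for v g
    using Suc.IH[OF that, of g] by (simp add: Z_def e_def mult_ac)
  \<comment> \<open>The sums with fewer derivatives vanish by induction, so Leibniz' rule makes
    \<open>Z w\<close> linear over series. Hence a and b can be pulled out below, and the two terms
    cancel.\<close>
  have Zmult: "Z w (c * f) = c * Z w f" for c
  proof -
    have "is_ideal ({0} :: 'a fps set)" by (simp add: is_ideal_def)
    from sum_derivs_const_mult[OF this, where w = w and S = "{..N}" and e = e and c = c and
        h = "\<lambda>i. f * a ^ (N - i) * b ^ i"] show ?thesis
      using Z0 Suc.prems unfolding Z_def by (simp add: mult.assoc)
  qed
  let ?t = "\<lambda>i. (fps_deriv ^^ w) (f * a ^ (Suc N - i) * b ^ i) * (a ^ i * b ^ (Suc N - i))"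
  have "(\<Sum>i\<le>Suc N. (-1) ^ i * of_nat (Suc N choose i) * ?t i) =
      (\<Sum>i\<le>N. (-1) ^ i * of_nat (N choose i) * (?t i - ?t (Suc i)))"
    by (rule alternating_binomial_sum_Suc)
  also have "\<dots> = (\<Sum>i\<le>N. b * (e i * (fps_deriv ^^ w) (a * f * a ^ (N - i) * b ^ i)) -
      a * (e i * (fps_deriv ^^ w) (b * f * a ^ (N - i) * b ^ i)))"
  proof (rule sum.cong)
    fix i assume "i \<in> {..N}"
    then have i: "Suc N - i = Suc (N - i)" by auto
    have "?t i = (fps_deriv ^^ w) (a * f * a ^ (N - i) * b ^ i) * (a ^ i * b ^ (N - i)) * b"
      unfolding i by (simp add: mult_ac)
    moreover have "?t (Suc i) = (fps_deriv ^^ w) (b * f * a ^ (N - i) * b ^ i) * (a ^ i * b ^ (N - i)) * a"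
      by (simp add: mult_ac)
    ultimately show "(-1) ^ i * of_nat (N choose i) * (?t i - ?t (Suc i)) =
      b * (e i * (fps_deriv ^^ w) (a * f * a ^ (N - i) * b ^ i)) -
      a * (e i * (fps_deriv ^^ w) (b * f * a ^ (N - i) * b ^ i))"
      unfolding e_def by (simp only:) (simp add: algebra_simps)
  qed simp
  also have "\<dots> = b * Z w (a * f) - a * Z w (b * f)"
    by (simp add: Z_def sum_subtractf sum_distrib_left)
  also have "\<dots> = 0" unfolding Zmult by (simp add: algebra_simps)
  finally show ?case .
qed simp

text \<open>Every summand has the factor a^(L-r) b^(s+1), and a^(L+1-r) b^s inside the derivative.
  What is left is \<open>alternating_derivs_eq_0\<close> for N = r-s-1, and the bound on w says w <
  N.\<close>

lemma alternating_derivs_monomials: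
  fixes a b :: "'a::comm_ring_1 fps"
  assumes "s + 2 \<le> r" "r \<le> L" "w \<le> r - s - 2"
  shows "(\<Sum>i\<le>r - s - 1. (-1) ^ i * of_nat ((r - s - 1) choose i) *
    ((fps_deriv ^^ w) (a ^ (L - (s + i)) * b ^ (s + i)) * (a ^ (L - (r - i)) * b ^ (r - i)))) = 0"
proof -
  let ?N = "r - s - 1" and ?f = "a ^ (L + 1 - r) * b ^ s"
  let ?g = "a ^ (L - r) * b ^ (s + 1)"
  have "(\<Sum>i\<le>?N. (-1) ^ i * of_nat (?N choose i) *
      ((fps_deriv ^^ w) (a ^ (L - (s + i)) * b ^ (s + i)) * (a ^ (L - (r - i)) * b ^ (r - i)))) =
    ?g * (\<Sum>i\<le>?N. (-1) ^ i * of_nat (?N choose i) *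
      ((fps_deriv ^^ w) (?f * a ^ (?N - i) * b ^ i) * (a ^ i * b ^ (?N - i))))"
    unfolding sum_distrib_left
  proof (rule sum.cong)
    fix i assume i: "i \<in> {..?N}"
    have "a ^ (L - (s + i)) * b ^ (s + i) = ?f * a ^ (?N - i) * b ^ i"
    proof -
      have "L - (s + i) = (L + 1 - r) + (?N - i)" using i assms by auto
      then show ?thesis by (simp only: power_add mult_ac)
    qed
    moreover have "a ^ (L - (r - i)) * b ^ (r - i) = ?g * (a ^ i * b ^ (?N - i))"
    proof -
      have "L - (r - i) = (L - r) + i" "r - i = (s + 1) + (?N - i)" using i assms by auto
      then show ?thesis by (simp only: power_add mult_ac)
    qed
    ultimately show "(-1) ^ i * of_nat (?N choose i) *
      ((fps_deriv ^^ w) (a ^ (L - (s + i)) * b ^ (s + i)) * (a ^ (L - (r - i)) * b ^ (r - i))) =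
      ?g * ((-1) ^ i * of_nat (?N choose i) *
      ((fps_deriv ^^ w) (?f * a ^ (?N - i) * b ^ i) * (a ^ i * b ^ (?N - i))))"
      by (simp only: mult_ac)
  qed simp
  also have "\<dots> = 0"
    using assms by (subst alternating_derivs_eq_0) auto
  finally show ?thesis .
qed

lemma Q_ser_alt:
  assumes "s + 2 \<le> r"
  shows "Q_ser s r w = (-1) ^ s * (\<Sum>i\<le>r - s - 1. (-1) ^ i * of_nat ((r - s - 1) choose i) *
    ((fps_deriv ^^ w) (x_ser (s + i)) * x_ser (r - i)))"
proof -
  have "Q_ser s r w = (\<Sum>i\<le>r - s - 1. (-1) ^ (s + i) * of_nat ((r - s - 1) choose (s + i - s))
                     * (fps_deriv ^^ w) (x_ser (s + i)) * x_ser (r + s - (s + i)))"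
    unfolding Q_ser_def using assms
    by (intro sum.reindex_bij_witness[of _ "\<lambda>i. s + i" "\<lambda>u. u - s"]) auto
  then show ?thesis
    by (simp add: sum_distrib_left power_add mult_ac)
qed

text \<open>The series x_j becomes a^(L-j) b^j, which turns the relation into
  \<open>alternating_derivs_monomials\<close>. The case l < L is what the induction on l with fixed
  \<open>nu L\<close> requires.\<close>

lemma nu_Q_gens:
  assumes "g \<in> Q_gens l" "l \<le> L" shows "nu L g = 0"
proof -
  obtain s r w n where g: "g = fps_nth (Q_ser s r w) n" and b: "s + 2 \<le> r" "r \<le> L" "w \<le> r - s - 2"
    using assms unfolding Q_gens_def by fastforce
  have m: "ring_map (map_fps (nu L))" by (rule ring_map_map_fps[OF ring_map_nu])
  have nat: "nu L (of_nat k) = of_nat k" for k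
    by (induction k) (simp_all add: ring_map_zero[OF ring_map_nu] ring_map_one[OF ring_map_nu]
        ring_map_add[OF ring_map_nu])
  have d: "map_fps (nu L) ((fps_deriv ^^ v) F) = (fps_deriv ^^ v) (map_fps (nu L) F)" for v F
    by (induction v) (simp_all add: fps_eq_iff ring_map_mult[OF ring_map_nu] nat del: of_nat_Suc)
  have c: "map_fps (nu L) (of_nat k) = of_nat k" for k
    by (induction k) (simp_all add: ring_map_zero[OF m] ring_map_one[OF m] ring_map_add[OF m])
  have neg: "map_fps (nu L) (- 1) = - 1"
    using ring_map_add[OF m, of 1 "- 1"] by (simp add: ring_map_zero[OF m] ring_map_one[OF m] eq_neg_iff_add_eq_0 add.commute)
  have "map_fps (nu L) (Q_ser s r w) = (-1) ^ s * (\<Sum>i\<le>r - s - 1. (-1) ^ i * of_nat ((r - s - 1) choose i) *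
    ((fps_deriv ^^ w) (a_ser ^ (L - (s + i)) * b_ser ^ (s + i)) * (a_ser ^ (L - (r - i)) * b_ser ^ (r - i))))"
    unfolding Q_ser_alt[OF b(1)]
    by (simp only: ring_map_mult[OF m] ring_map_sum[OF m] ring_map_power[OF m] d c neg map_fps_nu_x_ser)
  also have "\<dots> = 0" using alternating_derivs_monomials[OF b, of a_ser b_ser] by simp
  finally have "fps_nth (map_fps (nu L) (Q_ser s r w)) n = 0" by simp
  then show ?thesis by (simp add: g)
qed

subsection \<open>The quadratic relations are nilpotent on the arc scheme\<close>

text \<open>The square of x^(k+1) z is a multiple of x^(k+2) z, so the exponent of x can be lowered
  one at a time.\<close>

lemma radical_power_mult:
  assumes "is_ideal I" "\<And>p. p * p \<in> I \<Longrightarrow> p \<in> I" "x ^ Suc k * z \<in> I"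
  shows "x * z \<in> I"
  using assms(3)
proof (induction k)
  case (Suc k)
  have eq: "(x ^ Suc k * z) * (x ^ Suc k * z) = (x ^ k * z) * (x ^ Suc (Suc k) * z)"
    by (simp add: mult_ac)
  have "(x ^ Suc k * z) * (x ^ Suc k * z) \<in> I"
    unfolding eq by (rule is_ideal_mult[OF assms(1) Suc.prems])
  then show ?case by (intro Suc.IH) (rule assms(2))
qed simp

text \<open>From uv in I follows u'v + uv' in I. Multiplying by uv' and discarding the multiple u'v'
  of uv leaves the square of uv'.\<close>

lemma radical_differential_mult:
  fixes I :: "'a::comm_ring_1 fps set"
  assumes I: "is_ideal I" and sq: "\<And>p. p * p \<in> I \<Longrightarrow> p \<in> I"
    and deriv: "\<And>p. p \<in> I \<Longrightarrow> fps_deriv p \<in> I" and uv: "u * v \<in> I"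
  shows "u * (fps_deriv ^^ w) v \<in> I"
proof (induction w)
  case (Suc w)
  let ?v = "(fps_deriv ^^ w) v"
  have "(u * fps_deriv ?v) * (u * fps_deriv ?v) =
      (u * fps_deriv ?v) * fps_deriv (u * ?v) - (fps_deriv u * fps_deriv ?v) * (u * ?v)"
    by (simp add: algebra_simps)
  also have "\<dots> \<in> I"
    by (intro is_ideal_diff[OF I] is_ideal_mult[OF I] deriv Suc)
  finally show ?case unfolding funpow.simps o_apply by (rule sq)
qed (use uv in simp)

text \<open>Let Z be the sum. Multiplied by x_0^(l-1) the x_j become x_0^(l-j) x_1^j, for which the
  sum is zero. Removing the powers of x_0 gives x_0 Z, then x_j Z for j \<le> l-1, and finally the
  square of Z as a combination of products of Z with derivatives of the x_j.\<close>

lemma alternating_derivs_in_radical: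
  fixes x :: "nat \<Rightarrow> 'a::comm_ring_1 fps"
  assumes I: "is_ideal I" and sq: "\<And>p. p * p \<in> I \<Longrightarrow> p \<in> I"
    and deriv: "\<And>p. p \<in> I \<Longrightarrow> fps_deriv p \<in> I"
    and rel: "\<And>a b. 1 \<le> a \<Longrightarrow> a \<le> b \<Longrightarrow> b \<le> l - 1 \<Longrightarrow> x a * x b - x (a - 1) * x (b + 1) \<in> I"
    and b: "s + 2 \<le> r" "r \<le> l" "w \<le> r - s - 2"
  shows "(\<Sum>i\<le>r - s - 1. (-1) ^ i * of_nat ((r - s - 1) choose i) *
    ((fps_deriv ^^ w) (x (s + i)) * x (r - i))) \<in> I"
proof -
  let ?N = "r - s - 1"
  define c where "c = x 0 ^ (l - 1)"
  define e where "e i = (-1) ^ i * of_nat (?N choose i) * x (r - i)" for i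
  define Z where "Z v = (\<Sum>i\<le>?N. e i * (fps_deriv ^^ v) (x (s + i)))" for v
  have deriv_w: "(fps_deriv ^^ v) p \<in> I" if "p \<in> I" for v p
    using that by (induction v) (auto intro: deriv)
  have deriv_diff: "(fps_deriv ^^ v) (p - q) = (fps_deriv ^^ v) p - (fps_deriv ^^ v) q" for v and p q :: "'a fps"
    by (induction v) simp_all
  have pow: "x 0 ^ j * x (Suc j) - x 1 ^ Suc j \<in> I" if "Suc j \<le> l" for j
    using that
  proof (induction j)
    case 0
    then show ?case by (simp add: is_ideal_zero[OF I])
  next
    case (Suc j)
    have "x 0 ^ j * x (Suc j) - x 1 ^ Suc j \<in> I"
      and "x 1 * x (Suc j) - x (1 - 1) * x (Suc j + 1) \<in> I"
      using Suc rel[of 1 "Suc j"] by auto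
    then have "x 1 * (x 0 ^ j * x (Suc j) - x 1 ^ Suc j) -
        x 0 ^ j * (x 1 * x (Suc j) - x (1 - 1) * x (Suc j + 1)) \<in> I"
      by (rule is_ideal_diff[OF I is_ideal_mult[OF I] is_ideal_mult[OF I]])
    then show ?case by (simp add: algebra_simps)
  qed
  have c: "c * x j - x 0 ^ (l - j) * x 1 ^ j \<in> I" if "j \<le> l" for j
  proof (cases j)
    case 0
    have "c * x 0 = x 0 ^ l" unfolding c_def using b by (intro power_minus_mult) simp
    then show ?thesis using 0 by (simp add: is_ideal_zero[OF I])
  next
    case (Suc i)
    have "l - 1 = (l - j) + i" using that Suc by simp
    then have "c = x 0 ^ (l - j) * x 0 ^ i" by (simp add: c_def power_add)
    then have "c * x j - x 0 ^ (l - j) * x 1 ^ j = x 0 ^ (l - j) * (x 0 ^ i * x (Suc i) - x 1 ^ Suc i)"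
      by (simp add: Suc algebra_simps)
    then show ?thesis using pow[of i] that Suc by (simp add: is_ideal_mult[OF I])
  qed
  \<comment> \<open>The induction on v is needed because c can be moved out of a v-th derivative
    only when the sums with fewer derivatives, times c, are in I.\<close>
  have cZ: "c * Z v \<in> I" if "v \<le> r - s - 2" for v
    using that
  proof (induction v rule: less_induct)
    case (less v)
    have van: "(\<Sum>i\<le>?N. (c * e i) * (fps_deriv ^^ v') (x (s + i))) \<in> I" if "v' < v" for v'
      using less.IH[OF that] less.prems that by (simp add: Z_def sum_distrib_left mult.assoc)
    let ?y = "\<lambda>j. x 0 ^ (l - j) * x 1 ^ j"
    have "(\<Sum>i\<le>?N. (c * e i) * (fps_deriv ^^ v) (c * x (s + i))) =
      (\<Sum>i\<le>?N. (-1) ^ i * of_nat (?N choose i) * ((fps_deriv ^^ v) (c * x (s + i)) * (c * x (r - i)) -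
        (fps_deriv ^^ v) (?y (s + i)) * ?y (r - i))) +
      (\<Sum>i\<le>?N. (-1) ^ i * of_nat (?N choose i) * ((fps_deriv ^^ v) (?y (s + i)) * ?y (r - i)))"
      unfolding sum.distrib[symmetric] by (intro sum.cong) (simp_all add: e_def algebra_simps)
    also have "(\<Sum>i\<le>?N. (-1) ^ i * of_nat (?N choose i) * ((fps_deriv ^^ v) (?y (s + i)) * ?y (r - i))) = 0"
      by (rule alternating_derivs_monomials[OF b(1,2) less.prems])
    also have "(\<Sum>i\<le>?N. (-1) ^ i * of_nat (?N choose i) *
        ((fps_deriv ^^ v) (c * x (s + i)) * (c * x (r - i)) - (fps_deriv ^^ v) (?y (s + i)) * ?y (r - i))) + 0 \<in> I"
      unfolding add_0_right
    proof (rule is_ideal_sum[OF I], rule is_ideal_mult[OF I], rule is_ideal_diff_mult[OF I])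
      fix i assume "i \<in> {..?N}"
      then have i: "s + i \<le> l" "r - i \<le> l" using b by auto
      show "(fps_deriv ^^ v) (c * x (s + i)) - (fps_deriv ^^ v) (?y (s + i)) \<in> I"
        unfolding deriv_diff[symmetric] by (intro deriv_w c i)
      show "c * x (r - i) - ?y (r - i) \<in> I" by (rule c[OF i(2)])
    qed
    finally have "(\<Sum>i\<le>?N. (c * e i) * (fps_deriv ^^ v) (c * x (s + i))) \<in> I" .
    moreover have "(\<Sum>i\<le>?N. (c * e i) * (fps_deriv ^^ v) (c * x (s + i))) -
        c * (\<Sum>i\<le>?N. (c * e i) * (fps_deriv ^^ v) (x (s + i))) \<in> I"
      by (rule sum_derivs_const_mult[OF I van])
    ultimately have "(\<Sum>i\<le>?N. (c * e i) * (fps_deriv ^^ v) (c * x (s + i))) -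
        ((\<Sum>i\<le>?N. (c * e i) * (fps_deriv ^^ v) (c * x (s + i))) -
        c * (\<Sum>i\<le>?N. (c * e i) * (fps_deriv ^^ v) (x (s + i)))) \<in> I"
      by (rule is_ideal_diff[OF I])
    \<comment> \<open>One factor c stems from the derivatives, the other from the weights;
      radicality reduces two to one.\<close>
    then have "c * (c * Z v) \<in> I"
      by (simp add: Z_def sum_distrib_left mult.assoc)
    then have "Z v * (c * (c * Z v)) \<in> I" by (rule is_ideal_mult[OF I])
    then have "(c * Z v) * (c * Z v) \<in> I" by (simp add: mult_ac)
    then show ?case by (rule sq)
  qed
  have x0: "x 0 * Z w \<in> I"
  proof (rule radical_power_mult[OF I sq])
    have "x 0 * (c * Z w) \<in> I" by (rule is_ideal_mult[OF I cZ[OF b(3)]])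
    then show "x 0 ^ Suc (l - 1) * Z w \<in> I" by (simp add: c_def mult.assoc)
  qed
  have xj: "x j * Z w \<in> I" if "j \<le> l - 1" for j
    using that
  proof (induction j)
    case (Suc j)
    \<comment> \<open>Modulo I the square of x_(j+1) Z is (x_j Z)(x_(j+2) Z), whose first factor is
      in I.\<close>
    have "x (Suc j) * x (Suc j) - x (Suc j - 1) * x (Suc j + 1) \<in> I" and "x j * Z w \<in> I"
      using Suc rel[of "Suc j" "Suc j"] by auto
    then have "(Z w * Z w) * (x (Suc j) * x (Suc j) - x (Suc j - 1) * x (Suc j + 1)) +
        (Z w * x (Suc j + 1)) * (x j * Z w) \<in> I"
      by (rule is_ideal_add[OF I is_ideal_mult[OF I] is_ideal_mult[OF I]])
    then have "(x (Suc j) * Z w) * (x (Suc j) * Z w) \<in> I" by (simp add: algebra_simps)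
    then show ?case by (rule sq)
  qed (rule x0)
  \<comment> \<open>The derivatives fall on indices s + i \<le> r-1 \<le> l-1, which
    \<open>xj\<close> covers.\<close>
  have "Z w * (fps_deriv ^^ w) (x (s + i)) \<in> I" if "i \<le> ?N" for i
    using xj[of "s + i"] that b
    by (intro radical_differential_mult[OF I sq deriv]) (auto simp: mult.commute)
  then have "(\<Sum>i\<le>?N. e i * (Z w * (fps_deriv ^^ w) (x (s + i)))) \<in> I"
    by (rule is_ideal_sum[OF I is_ideal_mult[OF I]]) auto
  also have "(\<Sum>i\<le>?N. e i * (Z w * (fps_deriv ^^ w) (x (s + i)))) = Z w * Z w"
    by (subst (3) Z_def) (simp add: sum_distrib_left mult_ac)
  finally have "Z w \<in> I" by (rule sq)
  then show ?thesis by (simp add: Z_def e_def mult_ac)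
qed

section \<open>Radicals of generated ideals, for elements and for series\<close>

definition gen_radical :: "'a::comm_ring_1 set \<Rightarrow> 'a set" where
  "gen_radical G = {p. \<exists>n. p ^ n \<in> gen_ideal G}"

lemma is_ideal_gen_radical: "is_ideal (gen_radical G)"
  unfolding is_ideal_def
proof (intro conjI ballI allI)
  have "(0::'a) ^ 1 \<in> gen_ideal G" by (simp add: gen_ideal_zero)
  then show "0 \<in> gen_radical G" unfolding gen_radical_def by blast
next
  fix p q assume "p \<in> gen_radical G" "q \<in> gen_radical G"
  then obtain m n where m: "p ^ m \<in> gen_ideal G" and n: "q ^ n \<in> gen_ideal G"
    by (auto simp: gen_radical_def)
  have "(p + q) ^ (m + n) \<in> gen_ideal G"
    unfolding binomial_ring
  proof (rule gen_ideal_sum)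
    fix k assume "k \<in> {..m + n}"
    show "of_nat (m + n choose k) * p ^ k * q ^ (m + n - k) \<in> gen_ideal G"
    proof (cases "m \<le> k")
      case True
      then have "p ^ k = p ^ (k - m) * p ^ m" by (simp flip: power_add)
      then have "of_nat (m + n choose k) * p ^ k * q ^ (m + n - k) =
          (of_nat (m + n choose k) * p ^ (k - m) * q ^ (m + n - k)) * p ^ m" by (simp add: mult_ac)
      then show ?thesis using gen_ideal_mult[OF m] by simp
    next
      case False
      then have "q ^ (m + n - k) = q ^ (m - k) * q ^ n" by (simp flip: power_add)
      then have "of_nat (m + n choose k) * p ^ k * q ^ (m + n - k) =
          (of_nat (m + n choose k) * p ^ k * q ^ (m - k)) * q ^ n" by (simp add: mult_ac)
      then show ?thesis using gen_ideal_mult[OF n] by simp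
    qed
  qed
  then show "p + q \<in> gen_radical G" unfolding gen_radical_def by blast
next
  fix p h assume "p \<in> gen_radical G"
  then show "h * p \<in> gen_radical G"
    by (auto simp: gen_radical_def power_mult_distrib intro: gen_ideal_mult)
qed

lemma gen_radical_square: "p * p \<in> gen_radical G \<Longrightarrow> p \<in> gen_radical G"
  by (auto simp: gen_radical_def simp flip: power2_eq_square power_mult)

lemma gen_ideal_subset_ideal:
  assumes "is_ideal I" "G \<subseteq> I" "p \<in> gen_ideal G" shows "p \<in> I"
  using assms(3) by induction (use assms(1,2) in \<open>auto simp: is_ideal_def\<close>)

lemma is_ideal_fps: "is_ideal I \<Longrightarrow> is_ideal {F. \<forall>n. fps_nth F n \<in> I}"
  unfolding is_ideal_def[of "Collect _"]
  by (auto simp: fps_mult_nth intro!: is_ideal_sum is_ideal_zero is_ideal_add is_ideal_mult)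

text \<open>The coefficient of index 2n in F^2 is the square of the n-th coefficient of F, up to
  products containing an earlier coefficient.\<close>

lemma radical_fps:
  assumes I: "is_ideal I" and sq: "\<And>p. p * p \<in> I \<Longrightarrow> p \<in> I"
    and F: "\<And>n. fps_nth (F * F) n \<in> I"
  shows "fps_nth F n \<in> I"
proof (induction n rule: less_induct)
  case (less n)
  have "fps_nth (F * F) (2 * n) = (\<Sum>i=0..2 * n. fps_nth F i * fps_nth F (2 * n - i))"
    by (rule fps_mult_nth)
  also have "\<dots> = fps_nth F n * fps_nth F (2 * n - n) +
      (\<Sum>i\<in>{0..2 * n} - {n}. fps_nth F i * fps_nth F (2 * n - i))"
    by (rule sum.remove) auto
  finally have "fps_nth F n * fps_nth F n = fps_nth (F * F) (2 * n) -
      (\<Sum>i\<in>{0..2 * n} - {n}. fps_nth F i * fps_nth F (2 * n - i))" by simp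
  also have "\<dots> \<in> I"
  proof (intro is_ideal_diff[OF I] F is_ideal_sum[OF I])
    fix i assume "i \<in> {0..2 * n} - {n}"
    then have "i < n \<or> 2 * n - i < n" by auto
    then show "fps_nth F i * fps_nth F (2 * n - i) \<in> I"
      using less is_ideal_mult[OF I] is_ideal_mult_right[OF I] by blast
  qed
  finally show ?case by (rule sq)
qed

text \<open>The series with all coefficients in the radical form a radical ideal of the power series
  ring that is closed under derivation.\<close>

lemma Q_gens_in_radical: "Q_gens l \<subseteq> gen_radical (arc_gens l)"
proof
  fix g assume "g \<in> Q_gens l"
  then obtain s r w n where g: "g = fps_nth (Q_ser s r w) n"
    and b: "s + 2 \<le> r" "r \<le> l" "w \<le> r - s - 2" unfolding Q_gens_def by fastforce
  let ?I = "gen_radical (arc_gens l)" and ?J = "{F. \<forall>n. fps_nth F n \<in> gen_radical (arc_gens l)}"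
  have I: "is_ideal ?I" by (rule is_ideal_gen_radical)
  have J: "is_ideal ?J" by (rule is_ideal_fps[OF I])
  have "(\<Sum>i\<le>r - s - 1. (-1) ^ i * of_nat ((r - s - 1) choose i) *
    ((fps_deriv ^^ w) (x_ser (s + i)) * x_ser (r - i))) \<in> ?J"
  proof (rule alternating_derivs_in_radical[OF J])
    show "p \<in> ?J" if "p * p \<in> ?J" for p
      using that radical_fps[OF I gen_radical_square, of p] by auto
    show "fps_deriv p \<in> ?J" if "p \<in> ?J" for p
      using that by (auto intro: is_ideal_mult[OF I])
    show "x_ser i * x_ser j - x_ser (i - 1) * x_ser (j + 1) \<in> ?J" if "1 \<le> i" "i \<le> j" "j \<le> l - 1" for i j
    proof (intro CollectI allI)
      fix m
      have "fps_nth (x_ser i * x_ser j - x_ser (i - 1) * x_ser (j + 1)) m \<in> arc_gens l"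
        unfolding arc_gens_def using that by blast
      then have "fps_nth (x_ser i * x_ser j - x_ser (i - 1) * x_ser (j + 1)) m ^ 1 \<in> gen_ideal (arc_gens l)"
        by (simp only: power_one_right gen_ideal_gen)
      then show "fps_nth (x_ser i * x_ser j - x_ser (i - 1) * x_ser (j + 1)) m \<in> ?I"
        unfolding gen_radical_def by blast
    qed
  qed (use b in auto)
  from is_ideal_mult[OF J this, of "(-1) ^ s"] show "g \<in> ?I"
    unfolding g Q_ser_alt[OF b(1)] by blast
qed

subsection \<open>Descent to the polynomial ring in the given variables\<close>

definition retract :: "'v set \<Rightarrow> 'v cpoly \<Rightarrow> 'v cpoly" where
  "retract V = subst_hom (\<lambda>v. if v \<in> V then var v else 0)"

lemma ring_map_retract: "ring_map (retract V)"
  unfolding retract_def by (rule ring_map_subst_hom)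

lemma retract_ident: "p \<in> polys_in V \<Longrightarrow> retract V p = p"
  by (rule ring_map_eq_on_polys[OF _ ring_map_retract])
    (auto simp: ring_map_def retract_def subst_hom_const subst_hom_var)

lemma retract_in: "retract V p \<in> polys_in V"
  using polys_in_UNIV[of p]
proof (induction rule: polys_in_induct)
  case (const c)
  then show ?case by (simp add: retract_def subst_hom_const const_in_polys)
next
  case (add p q)
  then show ?case by (simp add: ring_map_add[OF ring_map_retract] add_in_polys)
next
  case (var v p)
  then show ?case
    by (simp add: ring_map_mult[OF ring_map_retract])
      (auto simp: retract_def subst_hom_var intro: mult_in_polys var_in_polys zero_in_polys)
qed

text \<open>Setting the variables outside V to zero fixes p and the generators and carries the
  cofactors into the polynomial ring over V.\<close>

lemma gen_ideal_imp_genideal: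
  assumes G: "G \<subseteq> polys_in V" and p: "p \<in> gen_ideal G" "p \<in> polys_in V"
  shows "p \<in> Idl\<^bsub>poly_ring V\<^esub> G"
proof -
  interpret cring "poly_ring V" by (rule cring_poly_ring)
  have G': "G \<subseteq> carrier (poly_ring V)" using G by (simp add: poly_ring_def)
  interpret J: ideal "Idl\<^bsub>poly_ring V\<^esub> G" "poly_ring V" by (rule genideal_ideal[OF G'])
  have "retract V p \<in> Idl\<^bsub>poly_ring V\<^esub> G"
    using p(1)
  proof induction
    case gen_ideal_zero
    then show ?case
      using J.zero_closed by (simp add: ring_map_zero[OF ring_map_retract] poly_ring_def)
  next
    case (gen_ideal_add_gen p g h)
    have "retract V h \<otimes>\<^bsub>poly_ring V\<^esub> g \<in> Idl\<^bsub>poly_ring V\<^esub> G"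
      using genideal_self[OF G'] gen_ideal_add_gen
      by (intro J.I_l_closed) (auto simp: poly_ring_def retract_in)
    then have "retract V p \<oplus>\<^bsub>poly_ring V\<^esub> (retract V h \<otimes>\<^bsub>poly_ring V\<^esub> g) \<in> Idl\<^bsub>poly_ring V\<^esub> G"
      using gen_ideal_add_gen by (intro J.a_closed)
    moreover have "retract V g = g" using G gen_ideal_add_gen by (intro retract_ident) auto
    ultimately show ?case
      by (simp add: poly_ring_def ring_map_add[OF ring_map_retract] ring_map_mult[OF ring_map_retract])
  qed
  then show ?thesis by (simp add: retract_ident[OF p(2)])
qed

lemma nat_pow_poly_ring: "p [^]\<^bsub>poly_ring V\<^esub> (n::nat) = p ^ n"
proof -
  interpret cring "poly_ring V" by (rule cring_poly_ring)
  show ?thesis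
    by (induction n) (simp_all, simp_all add: poly_ring_def mult.commute)
qed

subsection \<open>Homogeneity\<close>

definition mdegree :: "('v \<Rightarrow>\<^sub>0 nat) \<Rightarrow> nat" where
  "mdegree m = (\<Sum>v\<in>Poly_Mapping.keys m. Poly_Mapping.lookup m v)"

lemma mdegree_add: "mdegree (m + n) = mdegree m + mdegree n"
proof -
  let ?S = "Poly_Mapping.keys m \<union> Poly_Mapping.keys n"
  have *: "mdegree k = (\<Sum>v\<in>?S. Poly_Mapping.lookup k v)" if "Poly_Mapping.keys k \<subseteq> ?S" for k
    unfolding mdegree_def using that by (intro sum.mono_neutral_left) (auto simp: in_keys_iff)
  show ?thesis
    by (simp add: *[of m] *[of n] *[OF Poly_Mapping.keys_add] lookup_add sum.distrib)
qed

lemma homogeneous_iff: "homogeneous d p \<longleftrightarrow> (\<forall>m\<in>Poly_Mapping.keys p. mdegree m = d)"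
  by (simp add: homogeneous_def mdegree_def)

lemma homogeneous_zero: "homogeneous d 0"
  by (simp add: homogeneous_iff)

lemma homogeneous_add: "homogeneous d p \<Longrightarrow> homogeneous d q \<Longrightarrow> homogeneous d (p + q)"
  using Poly_Mapping.keys_add[of p q] by (auto simp: homogeneous_iff)

lemma homogeneous_sum: "(\<And>i. i \<in> S \<Longrightarrow> homogeneous d (f i)) \<Longrightarrow> homogeneous d (sum f S)"
  by (induction S rule: infinite_finite_induct) (auto intro: homogeneous_zero homogeneous_add)

lemma homogeneous_mult: "homogeneous d p \<Longrightarrow> homogeneous e q \<Longrightarrow> homogeneous (d + e) (p * q)"
  using Poly_Mapping.keys_mult[of p q] by (fastforce simp: homogeneous_iff mdegree_add)

lemma homogeneous_const: "homogeneous 0 (const c)"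
  by (auto simp: homogeneous_iff const_def mdegree_def)

lemma homogeneous_var: "homogeneous 1 (var v)"
  by (auto simp: homogeneous_iff var_def mdegree_def)

lemma homogeneous_of_int: "homogeneous 0 (of_int k)"
  using homogeneous_const[of "of_int k"] by (simp add: const_of_int)

lemma homogeneous_fps_mult:
  "(\<And>i. homogeneous d (fps_nth F i)) \<Longrightarrow> (\<And>i. homogeneous e (fps_nth H i)) \<Longrightarrow>
     homogeneous (d + e) (fps_nth (F * H) n)"
  unfolding fps_mult_nth by (intro homogeneous_sum homogeneous_mult)

lemma homogeneous_x_ser_deriv: "homogeneous 1 (fps_nth ((fps_deriv ^^ w) (x_ser u)) n)"
proof (induction w arbitrary: n)
  case 0
  then show ?case by (simp add: x_ser_def homogeneous_var[simplified])
next
  case (Suc w)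
  show ?case
    using homogeneous_mult[OF homogeneous_of_int[of "int (n + 1)"] Suc[of "n + 1"]]
    unfolding of_int_of_nat_eq by (simp add: algebra_simps)
qed

lemma homogeneous_Q_gens:
  assumes "q \<in> Q_gens l" shows "homogeneous 2 q"
proof -
  obtain s r w n where q: "q = fps_nth (Q_ser s r w) n"
    using assms unfolding Q_gens_def by blast
  have "homogeneous (0 + 1 + 1) (fps_nth ((-1) ^ u * of_nat k * (fps_deriv ^^ w) (x_ser u) * x_ser v) n)"
    for u v k
  proof (intro homogeneous_fps_mult homogeneous_x_ser_deriv)
    fix i
    have eq: "(-1) ^ u * of_nat k = (fps_const (of_int ((-1) ^ u * int k)) :: (nat \<times> nat) cpoly fps)"
      by (cases "even u") (simp_all flip: fps_of_nat)
    show "homogeneous 0 (fps_nth ((-1) ^ u * of_nat k :: (nat \<times> nat) cpoly fps) i)"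
      unfolding eq fps_nth_fps_const
      by (auto simp only: homogeneous_of_int homogeneous_zero split: if_split)
    show "homogeneous 1 (fps_nth (x_ser v) i)"
      using homogeneous_x_ser_deriv[of 0 v i] by simp
  qed
  then show ?thesis
    unfolding q Q_ser_def fps_sum_nth
    by (intro homogeneous_sum) (simp add: numeral_2_eq_2)
qed

section \<open>Radical of the arc ideal, kernel of \<open>nu\<close> and ideal of the quadratic
  relations\<close>

theorem theoremA:
  fixes l :: nat
  assumes "l \<ge> 1"
  shows "ideal_radical (x_ring l) (arc_ideal l) = a_kernel (x_ring l) ab_ring (nu l) \<and>
         a_kernel (x_ring l) ab_ring (nu l) = Idl\<^bsub>x_ring l\<^esub> (Q_gens l) \<and>
         (\<forall>q\<in>Q_gens l. homogeneous 2 q)"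
proof -
  let ?V = "{0..l} \<times> (UNIV :: nat set)"
  interpret R: cring "x_ring l" unfolding x_ring_def by (rule cring_poly_ring)
  interpret S: cring ab_ring unfolding ab_ring_def by (rule cring_poly_ring)
  interpret nu: ring_hom_ring "x_ring l" ab_ring "nu l"
    by (rule ring_hom_ringI2[OF R.ring_axioms S.ring_axioms nu_ring_hom])
  have carrier: "carrier (x_ring l) = polys_in ?V"
    by (simp add: x_ring_def poly_ring_def)
  have kernel: "a_kernel (x_ring l) ab_ring (nu l) = {p \<in> polys_in ?V. nu l p = 0}"
  proof -
    have "\<zero>\<^bsub>ab_ring\<^esub> = 0" by (simp add: ab_ring_def poly_ring_def)
    then show ?thesis by (simp only: a_kernel_def' carrier)
  qed
  have pow: "p [^]\<^bsub>x_ring l\<^esub> n = p ^ n" for p and n :: nat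
    by (simp add: x_ring_def nat_pow_poly_ring)
  have Q_kernel: "Idl\<^bsub>x_ring l\<^esub> (Q_gens l) \<subseteq> a_kernel (x_ring l) ab_ring (nu l)"
  proof (rule R.genideal_minimal[OF nu.kernel_is_ideal], rule subsetI)
    fix g assume g: "g \<in> Q_gens l"
    then show "g \<in> a_kernel (x_ring l) ab_ring (nu l)"
      using Q_gens_carrier[of l] unfolding kernel carrier by (auto intro: nu_Q_gens[OF g order.refl])
  qed
  have Q_ideal: "p \<in> gen_ideal (Q_gens l)" if "p \<in> a_kernel (x_ring l) ab_ring (nu l)" for p
  proof (rule kernel_subset_gen_ideal[OF assms _ order.refl])
    show "nu l g = 0" if "m \<le> l" "g \<in> Q_gens m" for m g
      by (rule nu_Q_gens[OF that(2,1)])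
    have "{0..l} = {..<Suc l}" by auto
    with that show "p \<in> polys_in ({..<Suc l} \<times> UNIV)" "nu l p = 0" unfolding kernel by auto
  qed
  have arc_kernel: "arc_ideal l \<subseteq> a_kernel (x_ring l) ab_ring (nu l)"
    unfolding arc_ideal_def
  proof (intro R.genideal_minimal[OF nu.kernel_is_ideal] subsetI)
    fix g assume g: "g \<in> arc_gens l"
    then obtain a b n where g': "g = fps_nth (x_ser a * x_ser b - x_ser (a - 1) * x_ser (b + 1)) n"
      and ab: "1 \<le> a" "a \<le> b" "b \<le> l - 1" unfolding arc_gens_def by blast
    let ?h = "map_fps (nu l)"
    have h: "ring_map ?h" by (rule ring_map_map_fps[OF ring_map_nu])
    \<comment> \<open>Both products map to the same monomial in a(t) and b(t); these splittings
      align the truncated exponents.\<close>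
    have e: "a_ser ^ (l - b) = a_ser * a_ser ^ (l - (b + 1))" "b_ser ^ a = b_ser * b_ser ^ (a - 1)"
      "a_ser ^ (l - (a - 1)) = a_ser * a_ser ^ (l - a)"
    proof -
      have "l - b = Suc (l - (b + 1))" "a = Suc (a - 1)" "l - (a - 1) = Suc (l - a)" using ab by auto
      then show "a_ser ^ (l - b) = a_ser * a_ser ^ (l - (b + 1))" "b_ser ^ a = b_ser * b_ser ^ (a - 1)"
        "a_ser ^ (l - (a - 1)) = a_ser * a_ser ^ (l - a)"
        by (metis power_Suc)+
    qed
    have "?h (x_ser a * x_ser b) = ?h (x_ser (a - 1) * x_ser (b + 1))"
      by (simp only: ring_map_mult[OF h] map_fps_nu_x_ser e power_add power_one_right mult_ac)
    moreover have "?h (x_ser a * x_ser b) =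
        ?h (x_ser a * x_ser b - x_ser (a - 1) * x_ser (b + 1)) + ?h (x_ser (a - 1) * x_ser (b + 1))"
      by (simp flip: ring_map_add[OF h])
    ultimately have "?h (x_ser a * x_ser b - x_ser (a - 1) * x_ser (b + 1)) = 0" by simp
    from arg_cong[OF this, of "\<lambda>F. fps_nth F n"] have "nu l g = 0" by (simp only: g' map_fps_nth fps_zero_nth)
    then show "g \<in> a_kernel (x_ring l) ab_ring (nu l)"
      using g arc_gens_carrier[of l] by (auto simp: kernel carrier)
  qed
  have "ideal_radical (x_ring l) (arc_ideal l) = a_kernel (x_ring l) ab_ring (nu l)"
  proof (intro equalityI subsetI)
    fix p assume "p \<in> ideal_radical (x_ring l) (arc_ideal l)"
    then obtain n :: nat where p: "p \<in> polys_in ?V" "p [^]\<^bsub>x_ring l\<^esub> n \<in> arc_ideal l"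
      by (auto simp: ideal_radical_def carrier)
    then have "nu l (p ^ n) = 0"
      using arc_kernel unfolding pow kernel by blast
    \<comment> \<open>The target is a domain and has no nilpotents.\<close>
    then have "nu l p = 0" by (simp add: ring_map_power[OF ring_map_nu])
    then show "p \<in> a_kernel (x_ring l) ab_ring (nu l)" using p by (simp add: kernel)
  next
    fix p assume p: "p \<in> a_kernel (x_ring l) ab_ring (nu l)"
    then have pV: "p \<in> polys_in ?V" by (simp add: kernel)
    have "p \<in> gen_radical (arc_gens l)"
      using gen_ideal_subset_ideal[OF is_ideal_gen_radical Q_gens_in_radical Q_ideal[OF p]] .
    then obtain n where n: "p ^ n \<in> gen_ideal (arc_gens l)" by (auto simp: gen_radical_def)
    have "p ^ n \<in> polys_in ?V"
      using pV by (induction n) (auto intro: one_in_polys mult_in_polys)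
    then have "p ^ n \<in> arc_ideal l"
      using gen_ideal_imp_genideal[OF _ n, of ?V] arc_gens_carrier[of l]
      by (simp add: arc_ideal_def x_ring_def poly_ring_def)
    then show "p \<in> ideal_radical (x_ring l) (arc_ideal l)"
      using pV unfolding ideal_radical_def carrier pow by blast
  qed
  moreover have "a_kernel (x_ring l) ab_ring (nu l) \<subseteq> Idl\<^bsub>x_ring l\<^esub> (Q_gens l)"
  proof
    fix p assume p: "p \<in> a_kernel (x_ring l) ab_ring (nu l)"
    then have "p \<in> polys_in ?V" unfolding kernel by blast
    then show "p \<in> Idl\<^bsub>x_ring l\<^esub> (Q_gens l)"
      using gen_ideal_imp_genideal[OF _ Q_ideal[OF p], of ?V] Q_gens_carrier[of l]
      by (simp add: x_ring_def poly_ring_def)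
  qed
  ultimately show ?thesis using Q_kernel homogeneous_Q_gens by blast
qed

end
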